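(* The process $Y_n:=Y_{n}^B:= Y+ \overline{Z}_{n-1}^{B,r}$ is an $\mathfrak{F}$-adapted and right-continuous stochastic process and satisfies $$Z_{n}^{B}(\sigma)= \operatorname*{ess\,sup}_{\tau\in \mathcal{S}_\sigma}\; \mathbb{E}(Y_{n}(\tau)\,|\,\mathcal{F}_\sigma)$$ (almost surely) for all $\sigma\in\mathcal{S}$.
   Context: $(\Omega,\mathcal{F},\mathbb{P})$ is a probability space with a filtration $\mathfrak{F}=(\mathcal{F}_t)_{t\ge 0}$ satisfying the usual conditions (right-continuous, $\mathcal{F}_0$ contains all $\mathbb{P}$-null sets); $\mathcal{F}_\infty=\sigma(\bigcup_{t\ge0}\mathcal{F}_t)$. $Y=(Y(t))_{t\ge0}$ is an $\mathfrak{F}$-adapted, non-negative, right-continuous process with $\mathbb{E}(\sup_{t\ge0}Y(t))<\infty$, and $Y(+\infty):=\limsup_{t\to\infty}Y(t)$. $\mathcal{S}$ is the set of all $\mathfrak{F}$-stopping times with values in $[0,\infty]$, and $\mathcal{S}_\sigma:=\{\tau\in\mathcal{S}:\tau\ge\sigma\}$. $n\ge1$ is a fixed integer. $X=(X(t))_{t\ge0}$ is a further $\mathfrak{F}$-adapted right-continuous process and $B=(B_1,\dots,B_{n-1})$ are Borel subsets of its state space, such that for all $i<n$ and $s\ge0$: $\bigcap_{t>s}\{X(t)\notin B_i\}$ is a $\mathbb{P}$-null set, and $\rho_s^{B_i}:=\inf\{t>s: X(t)\in B_i\}$ is an $\mathfrak{F}$-stopping time. For a stopping time $\tau$, $\rho_\tau^{B_i}:=\inf\{t>\tau: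 X(t)\in B_i\}$ ($\inf\emptyset=\infty$). Write $LB:=(B_2,\dots,B_{n-1})$. For $m\ge1$ and a tuple $C=(C_1,\dots,C_{m-1})$ of such sets, $\mathcal{S}_\sigma^m(C):=\{\tau\in\mathcal{S}^m:\sigma\le\tau_1,\ \rho_{\tau_i}^{C_i}\le\tau_{i+1}\text{ for all }i<m\}$ and $Z_m^C(\sigma):=\operatorname*{ess\,sup}_{\tau\in\mathcal{S}_\sigma^m(C)}\mathbb{E}\bigl(\sum_{i=1}^mY(\tau_i)\,|\,\mathcal{F}_\sigma\bigr)$; $Z_0\equiv0$ (so for $n=1$ the process below is $0$). The process $\overline{Z}_{n-1}^{B}(t):=\mathbb{E}\bigl(Z_{n-1}^{LB}(\rho_t^{B_1})\,|\,\mathcal{F}_t\bigr)$ is a supermartingale having a right-continuous modification, and $\overline{Z}_{n-1}^{B,r}$ denotes such a right-continuous modification. At $t=+\infty$ one uses the same formula, i.e. $\overline{Z}_{n-1}^{B,r}(+\infty)=\overline{Z}_{n-1}^{B}(+\infty)=(n-1)Y(+\infty)$. *)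

theory Defs
  imports "HOL-Probability.Probability"
begin

text \<open>
  Time runs through \<open>[0, \<infinity>]\<close>, modelled by the type \<^typ>\<open>ennreal\<close>.  A process on \<open>[0, \<infinity>)\<close> is
  a function on \<^typ>\<open>ennreal\<close> about which only the times \<open>t < \<infinity>\<close> are constrained.  Since the
  index \<open>\<infinity>\<close> is present in the filtration, the library notions \<^const>\<open>stopping_time\<close> and
  \<^const>\<open>filtration.pre_sigma\<close> are the usual ones for \<open>[0, \<infinity>]\<close>-valued stopping times, the members
  of \<open>\<F>\<^sub>\<sigma>\<close> being sets of \<open>\<F>\<^sub>\<infinity>\<close>.
\<close>

definition usual_filtration :: "'a measure \<Rightarrow> (ennreal \<Rightarrow> 'a measure) \<Rightarrow> bool" where
  "usual_filtration M F \<longleftrightarrow>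
     filtration (space M) F \<and>
     (\<forall>t<\<infinity>. sets (F t) \<subseteq> sets M) \<and>
     (\<forall>t<\<infinity>. sets (F t) = (\<Inter>u\<in>{t<..<\<infinity>}. sets (F u))) \<and>
     null_sets M \<subseteq> sets (F 0) \<and>
     sets (F \<infinity>) = sigma_sets (space M) (\<Union>t\<in>{..<\<infinity>}. sets (F t))"

definition adapted_process ::
  "(ennreal \<Rightarrow> 'a measure) \<Rightarrow> (ennreal \<Rightarrow> 'a \<Rightarrow> 'b::topological_space) \<Rightarrow> bool" where
  "adapted_process F X \<longleftrightarrow> (\<forall>t<\<infinity>. X t \<in> borel_measurable (F t))"

definition right_continuous_process ::
  "'a measure \<Rightarrow> (ennreal \<Rightarrow> 'a \<Rightarrow> 'b::topological_space) \<Rightarrow> bool" where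
  "right_continuous_process M X \<longleftrightarrow>
     (\<forall>\<omega>\<in>space M. \<forall>t<\<infinity>. ((\<lambda>s. X s \<omega>) \<longlongrightarrow> X t \<omega>) (at_right t))"

text \<open>
  \<open>R\<close> is a modification of \<open>Z\<close>, the index \<open>\<infinity>\<close> included.  Only measurability with respect to
  \<open>M\<close> is required, not adaptedness.
\<close>
definition modification ::
  "'a measure \<Rightarrow> (ennreal \<Rightarrow> 'a \<Rightarrow> real) \<Rightarrow> (ennreal \<Rightarrow> 'a \<Rightarrow> real) \<Rightarrow> bool" where
  "modification M Z R \<longleftrightarrow>
     (\<forall>t. R t \<in> borel_measurable M) \<and> (\<forall>t. AE \<omega> in M. R t \<omega> = Z t \<omega>)"

text \<open>
  Essential supremum of a family of random variables (the library's \<^const>\<open>esssup\<close> is that of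
  a single function).
\<close>
definition is_ess_sup :: "'a measure \<Rightarrow> ('a \<Rightarrow> real) set \<Rightarrow> ('a \<Rightarrow> real) \<Rightarrow> bool" where
  "is_ess_sup M H Z \<longleftrightarrow>
     Z \<in> borel_measurable M \<and>
     (\<forall>h\<in>H. AE \<omega> in M. h \<omega> \<le> Z \<omega>) \<and>
     (\<forall>Z'\<in>borel_measurable M. (\<forall>h\<in>H. AE \<omega> in M. h \<omega> \<le> Z' \<omega>) \<longrightarrow> (AE \<omega> in M. Z \<omega> \<le> Z' \<omega>))"

definition ess_sup :: "'a measure \<Rightarrow> ('a \<Rightarrow> real) set \<Rightarrow> 'a \<Rightarrow> real" where
  "ess_sup M H = (SOME Z. is_ess_sup M H Z)"

lemma is_ess_sup_unique:
  assumes "is_ess_sup M H Z" "is_ess_sup M H Z'"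
  shows "AE \<omega> in M. Z \<omega> = Z' \<omega>"
proof -
  have "AE \<omega> in M. Z \<omega> \<le> Z' \<omega>" "AE \<omega> in M. Z' \<omega> \<le> Z \<omega>"
    using assms by (auto simp: is_ess_sup_def)
  then show ?thesis by eventually_elim simp
qed

text \<open>\<open>\<E>(f | \<F>\<^sub>\<sigma>)\<close>\<close>
definition cond_exp_at ::
  "'a measure \<Rightarrow> (ennreal \<Rightarrow> 'a measure) \<Rightarrow> ('a \<Rightarrow> ennreal) \<Rightarrow> ('a \<Rightarrow> real) \<Rightarrow> 'a \<Rightarrow> real" where
  "cond_exp_at M F \<sigma> f = real_cond_exp M (filtration.pre_sigma (space M) F \<sigma>) f"

text \<open>\<open>\<rho>\<^sub>\<tau>\<^sup>D = inf {t > \<tau>. X(t) \<in> D}\<close>, where \<open>t\<close> is finite and the infimum of the empty set is \<open>\<infinity>\<close>.\<close>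
definition entry_after ::
  "(ennreal \<Rightarrow> 'a \<Rightarrow> 'b) \<Rightarrow> 'b set \<Rightarrow> ('a \<Rightarrow> ennreal) \<Rightarrow> 'a \<Rightarrow> ennreal" where
  "entry_after X D \<tau> \<omega> = Inf {t. \<tau> \<omega> < t \<and> t < \<infinity> \<and> X t \<omega> \<in> D}"

definition stopping_times_from ::
  "'a measure \<Rightarrow> (ennreal \<Rightarrow> 'a measure) \<Rightarrow> ('a \<Rightarrow> ennreal) \<Rightarrow> ('a \<Rightarrow> ennreal) set" where
  "stopping_times_from M F \<sigma> = {\<tau>. stopping_time F \<tau> \<and> (\<forall>\<omega>\<in>space M. \<sigma> \<omega> \<le> \<tau> \<omega>)}"

text \<open>
  \<open>\<S>\<^sub>\<sigma>\<^sup>m(C)\<close> for \<open>m \<ge> 1\<close>.  Tuples are functions on \<^typ>\<open>nat\<close>: only \<open>\<tau> 1, \<dots>, \<tau> m\<close> and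
  \<open>C 1, \<dots>, C (m - 1)\<close> matter.
\<close>
definition multi_stopping_times ::
  "'a measure \<Rightarrow> (ennreal \<Rightarrow> 'a measure) \<Rightarrow> (ennreal \<Rightarrow> 'a \<Rightarrow> 'b) \<Rightarrow>
   nat \<Rightarrow> (nat \<Rightarrow> 'b set) \<Rightarrow> ('a \<Rightarrow> ennreal) \<Rightarrow> (nat \<Rightarrow> 'a \<Rightarrow> ennreal) set" where
  "multi_stopping_times M F X m C \<sigma> =
     {\<tau>. (\<forall>i\<in>{1..m}. stopping_time F (\<tau> i)) \<and>
         (\<forall>\<omega>\<in>space M. \<sigma> \<omega> \<le> \<tau> 1 \<omega>) \<and>
         (\<forall>i\<in>{1..<m}. \<forall>\<omega>\<in>space M. entry_after X (C i) (\<tau> i) \<omega> \<le> \<tau> (Suc i) \<omega>)}"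

text \<open>\<open>Z\<^sub>m\<^sup>C(\<sigma>)\<close>\<close>
definition multi_value ::
  "'a measure \<Rightarrow> (ennreal \<Rightarrow> 'a measure) \<Rightarrow> (ennreal \<Rightarrow> 'a \<Rightarrow> 'b) \<Rightarrow> (ennreal \<Rightarrow> 'a \<Rightarrow> real) \<Rightarrow>
   nat \<Rightarrow> (nat \<Rightarrow> 'b set) \<Rightarrow> ('a \<Rightarrow> ennreal) \<Rightarrow> 'a \<Rightarrow> real" where
  "multi_value M F X Y m C \<sigma> =
     (if m = 0 then (\<lambda>\<omega>. 0)
      else ess_sup M ((\<lambda>\<tau>. cond_exp_at M F \<sigma> (\<lambda>\<omega>. \<Sum>i=1..m. Y (\<tau> i \<omega>) \<omega>))
                        ` multi_stopping_times M F X m C \<sigma>))"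

text \<open>
  The process \<open>t \<mapsto> \<E>(Z\<^sub>m\<^sup>L\<^sup>B(\<rho>\<^sub>t) | \<F>\<^sub>t)\<close> for \<open>B = (B 1, \<dots>, B m)\<close>, with \<open>\<rho>\<^sub>t\<close> the entry time into \<open>B 1\<close>
  and \<open>LB = (B 2, \<dots>, B m)\<close>.  The same formula is used at \<open>t = \<infinity>\<close>, where \<open>\<rho>\<^sub>t = \<infinity>\<close>.
\<close>
definition multi_value_next ::
  "'a measure \<Rightarrow> (ennreal \<Rightarrow> 'a measure) \<Rightarrow> (ennreal \<Rightarrow> 'a \<Rightarrow> 'b) \<Rightarrow> (ennreal \<Rightarrow> 'a \<Rightarrow> real) \<Rightarrow>
   nat \<Rightarrow> (nat \<Rightarrow> 'b set) \<Rightarrow> ennreal \<Rightarrow> 'a \<Rightarrow> real" where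
  "multi_value_next M F X Y m B t =
     real_cond_exp M (F t)
       (multi_value M F X Y m (\<lambda>i. B (Suc i)) (entry_after X (B 1) (\<lambda>_. t)))"

text \<open>
  The value of \<open>Y\<close> at \<open>\<infinity>\<close> is the upper limit along finite times.  It is taken in \<^typ>\<open>ereal\<close>; on
  the set where it is infinite, a null set if \<open>\<E>(sup\<^sub>t Y(t)) < \<infinity>\<close>, the real value is \<open>0\<close>.
\<close>
definition limsup_at_infinity :: "'a measure \<Rightarrow> (ennreal \<Rightarrow> 'a \<Rightarrow> real) \<Rightarrow> bool" where
  "limsup_at_infinity M Y \<longleftrightarrow>
     (\<forall>\<omega>\<in>space M. Y \<infinity> \<omega> = real_of_ereal (Limsup (at_left \<infinity>) (\<lambda>t. ereal (Y t \<omega>))))"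

end

(* By directedness, the integral of Z_m(sigma) over an event of F_sigma is the supremum of the
   integrals of the rewards over all tuples starting at sigma.  Hence Z_m(sigma) depends only locally on
   sigma, and its integrals are right-continuous in sigma: a tuple starting at sigma becomes one
   starting at a slightly later time when its entries are delayed as little as possible.  Since R is
   right-continuous and uniformly integrable along approximations from the right, R(tau) is, for
   every stopping time tau, the conditional expectation of Z_{n-1}(rho_tau) given F_tau.
   So stopping at tau in the problem for Y + R is worth as much as stopping first at tau and then
   optimally from rho_tau on. *)

theory Submission
  imports Defs
begin

text \<open>The obstacle is that \<open>Z_m(\<sigma>)\<close> is an essential supremum chosen
  separately for each \<open>\<sigma>\<close>, and only up to null sets. It has no paths, so a
  random time cannot simply be substituted for \<open>t\<close> in \<open>Z_m(\<rho>_t)\<close>, and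
  optimal tuples need not exist. Identities about the value are therefore tested by integrating over
  events, where null sets disappear and tuples optimal up to \<open>e\<close> suffice. The process
  \<open>R\<close> does have paths, but it is tied to the value only at each fixed time, outside a
  null set depending on that time. The two meet at times with finitely many values: there fixed-time
  identities can be added up. From such times one passes to a general \<open>\<tau>\<close> on two
  different grounds, for \<open>R\<close> by convergence of paths and for the value by convergence
  of integrals. Equating the two limits needs more than Fatou's lemma. The missing bound comes from
  splitting \<open>m\<close> times the dominating variable at a high level: the excess keeps its
  small mean under conditioning at any finitely valued time.\<close>

section \<open>Essential suprema of directed families\<close>

text \<open>Exhaustion: an almost surely increasing sequence in \<open>H\<close> whose integrals
  tend to their supremum \<open>s\<close> has a limit \<open>Z\<close> with integral exactly
  \<open>s\<close>, and directedness leaves no room for a member of \<open>H\<close> to exceed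
  \<open>Z\<close>. The bound \<open>W\<close> is what makes \<open>s\<close> finite and the limits
  dominated.\<close>

lemma ess_sup_directed:
  fixes W :: "'a \<Rightarrow> real"
  assumes ne: "H \<noteq> {}"
    and int: "\<And>h. h \<in> H \<Longrightarrow> integrable M h"
    and W: "integrable M W" "\<And>h. h \<in> H \<Longrightarrow> AE \<omega> in M. h \<omega> \<le> W \<omega>"
    and dir: "\<And>h h'. h \<in> H \<Longrightarrow> h' \<in> H \<Longrightarrow> \<exists>k\<in>H. AE \<omega> in M. max (h \<omega>) (h' \<omega>) \<le> k \<omega>"
  shows "is_ess_sup M H (ess_sup M H)"
    and "integrable M (ess_sup M H)"
    and "e > 0 \<Longrightarrow> \<exists>h\<in>H. (\<integral>\<omega>. ess_sup M H \<omega> \<partial>M) \<le> (\<integral>\<omega>. h \<omega> \<partial>M) + e"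
proof -
  define s where "s = (SUP h\<in>H. integral\<^sup>L M h)"
  have bdd: "bdd_above (integral\<^sup>L M ` H)"
    using int W by (intro bdd_aboveI2[where M="integral\<^sup>L M W"] integral_mono_AE)
  have le_s: "integral\<^sup>L M h \<le> s" if "h \<in> H" for h
    unfolding s_def by (rule cSUP_upper[OF that bdd])
  have approx: "\<exists>h\<in>H. s - d < integral\<^sup>L M h" if "d > 0" for d
    using less_cSUP_iff[OF ne bdd, of "s - d"] that by (auto simp: s_def)
  \<comment> \<open>Dependent choice, since each new member must lie above the previous one as well
    as come close to \<open>s\<close>.\<close>
  have "\<exists>f. \<forall>n::nat. (f n \<in> H \<and> s - 1 / real (Suc n) < integral\<^sup>L M (f n)) \<and>
      (AE \<omega> in M. f n \<omega> \<le> f (Suc n) \<omega>)"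
  proof (rule dependent_nat_choice)
    show "\<exists>f. f \<in> H \<and> s - 1 / real (Suc 0) < integral\<^sup>L M f"
      using approx[of 1] by auto
  next
    fix f :: "'a \<Rightarrow> real" and n :: nat
    assume f: "f \<in> H \<and> s - 1 / real (Suc n) < integral\<^sup>L M f"
    obtain h where h: "h \<in> H" "s - 1 / real (Suc (Suc n)) < integral\<^sup>L M h"
      using approx[of "1 / real (Suc (Suc n))"] by auto
    obtain k where k: "k \<in> H" "AE \<omega> in M. max (f \<omega>) (h \<omega>) \<le> k \<omega>"
      using dir f h(1) by blast
    have "integral\<^sup>L M h \<le> integral\<^sup>L M k"
      using h k int by (intro integral_mono_AE) auto
    moreover have "AE \<omega> in M. f \<omega> \<le> k \<omega>"
      using k by auto
    ultimately show "\<exists>k. (k \<in> H \<and> s - 1 / real (Suc (Suc n)) < integral\<^sup>L M k) \<and>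
        (AE \<omega> in M. f \<omega> \<le> k \<omega>)"
      using k(1) h(2) by (intro exI[of _ k]) auto
  qed
  then obtain f where f: "\<And>n::nat. f n \<in> H" "\<And>n. s - 1 / real (Suc n) < integral\<^sup>L M (f n)"
    "\<And>n. AE \<omega> in M. f n \<omega> \<le> f (Suc n) \<omega>"
    by auto
  note [measurable] = borel_measurable_integrable[OF int[OF f(1)]]
    borel_measurable_integrable[OF W(1)]
  define Z where "Z = (\<lambda>\<omega>. lim (\<lambda>n. f n \<omega>))"
  have Z_meas[measurable]: "Z \<in> borel_measurable M"
    unfolding Z_def by measurable
  have AEinc: "AE \<omega> in M. incseq (\<lambda>n. f n \<omega>)"
    using f(3) by (simp add: incseq_Suc_iff AE_all_countable)
  have AEW: "AE \<omega> in M. \<forall>n. f n \<omega> \<le> W \<omega>"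
    using W(2) f(1) by (simp add: AE_all_countable)
  have lim: "AE \<omega> in M. (\<lambda>n. f n \<omega>) \<longlonglongrightarrow> Z \<omega>"
    using AEinc AEW
  proof eventually_elim
    case (elim \<omega>)
    then have "convergent (\<lambda>n. f n \<omega>)"
      by (metis convergentI incseq_convergent)
    then show ?case
      unfolding Z_def by (simp add: convergent_LIMSEQ_iff)
  qed
  \<comment> \<open>Every \<open>f n\<close> lies between \<open>f 0\<close> and \<open>W\<close>,
    neither of which has a sign.\<close>
  have bound: "AE \<omega> in M. \<forall>n. norm (f n \<omega>) \<le> \<bar>f 0 \<omega>\<bar> + \<bar>W \<omega>\<bar>"
    using AEinc AEW
  proof eventually_elim
    case (elim \<omega>)
    then have "f 0 \<omega> \<le> f n \<omega>" "f n \<omega> \<le> W \<omega>" for n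
      by (auto simp: incseq_def)
    then have "\<bar>f n \<omega>\<bar> \<le> \<bar>f 0 \<omega>\<bar> + \<bar>W \<omega>\<bar>" for n
      by (smt (verit, ccfv_SIG))
    then show ?case
      by simp
  qed
  have intB: "integrable M (\<lambda>\<omega>. \<bar>f 0 \<omega>\<bar> + \<bar>W \<omega>\<bar>)"
    using int[OF f(1)] W(1) by auto
  have intZ: "integrable M Z"
    using lim bound by (intro integrable_dominated_convergence[OF _ _ intB, of Z f]) (auto simp: AE_all_countable)
  have "(\<lambda>n. integral\<^sup>L M (f n)) \<longlonglongrightarrow> integral\<^sup>L M Z"
    using lim bound by (intro integral_dominated_convergence[OF _ _ intB]) (auto simp: AE_all_countable)
  moreover have "(\<lambda>n. integral\<^sup>L M (f n)) \<longlonglongrightarrow> s"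
  proof (rule tendsto_sandwich)
    show "\<forall>\<^sub>F n in sequentially. s - 1 / real (Suc n) \<le> integral\<^sup>L M (f n)"
      using f(2) by (intro always_eventually allI less_imp_le) auto
    show "\<forall>\<^sub>F n in sequentially. integral\<^sup>L M (f n) \<le> s"
      using f(1) le_s by auto
    show "(\<lambda>n. s - 1 / real (Suc n)) \<longlonglongrightarrow> s"
      using tendsto_diff[OF tendsto_const LIMSEQ_Suc[OF lim_1_over_n], of s] by simp
  qed simp
  ultimately have Zs: "integral\<^sup>L M Z = s"
    using LIMSEQ_unique by blast
  have upper: "AE \<omega> in M. h \<omega> \<le> Z \<omega>" if h: "h \<in> H" for h
  proof -
    note [measurable] = borel_measurable_integrable[OF int[OF h]]
    have le: "(\<integral>\<omega>. max (h \<omega>) (f n \<omega>) \<partial>M) \<le> s" for n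
    proof -
      obtain k where k: "k \<in> H" "AE \<omega> in M. max (h \<omega>) (f n \<omega>) \<le> k \<omega>"
        using dir h f(1) by blast
      have "(\<integral>\<omega>. max (h \<omega>) (f n \<omega>) \<partial>M) \<le> integral\<^sup>L M k"
        using k int h f(1) by (intro integral_mono_AE) auto
      then show ?thesis
        using le_s[OF k(1)] by simp
    qed
    have "(\<lambda>n. \<integral>\<omega>. max (h \<omega>) (f n \<omega>) \<partial>M) \<longlonglongrightarrow> (\<integral>\<omega>. max (h \<omega>) (Z \<omega>) \<partial>M)"
    proof (rule integral_dominated_convergence)
      show "integrable M (\<lambda>\<omega>. \<bar>h \<omega>\<bar> + (\<bar>f 0 \<omega>\<bar> + \<bar>W \<omega>\<bar>))"
        using int[OF h] intB by auto
      show "AE \<omega> in M. (\<lambda>n. max (h \<omega>) (f n \<omega>)) \<longlonglongrightarrow> max (h \<omega>) (Z \<omega>)"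
        using lim by eventually_elim (intro tendsto_intros)
      show "AE \<omega> in M. norm (max (h \<omega>) (f n \<omega>)) \<le> \<bar>h \<omega>\<bar> + (\<bar>f 0 \<omega>\<bar> + \<bar>W \<omega>\<bar>)" for n
        using bound by eventually_elim (smt (verit) real_norm_def)
    qed measurable
    then have "(\<integral>\<omega>. max (h \<omega>) (Z \<omega>) \<partial>M) \<le> s"
      using le LIMSEQ_le_const2 by blast
    \<comment> \<open>The integrand is nonnegative and \<open>s\<close> is the integral of
      \<open>Z\<close>, so \<open>max h Z\<close> and \<open>Z\<close> must agree almost
      everywhere.\<close>
    then have "(\<integral>\<omega>. max (h \<omega>) (Z \<omega>) - Z \<omega> \<partial>M) \<le> 0"
      using int[OF h] intZ by (subst Bochner_Integration.integral_diff) (auto simp: Zs)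
    then have "(\<integral>\<omega>. max (h \<omega>) (Z \<omega>) - Z \<omega> \<partial>M) = 0"
      by (intro antisym integral_nonneg_AE) auto
    then have "AE \<omega> in M. max (h \<omega>) (Z \<omega>) - Z \<omega> = 0"
      using int[OF h] intZ by (subst (asm) integral_nonneg_eq_0_iff_AE) auto
    then show ?thesis
      by eventually_elim (simp add: max_def split: if_splits)
  qed
  have "is_ess_sup M H Z"
    unfolding is_ess_sup_def
  proof (intro conjI ballI impI Z_meas upper)
    fix Z' assume "\<forall>h\<in>H. AE \<omega> in M. h \<omega> \<le> Z' \<omega>"
    then have "AE \<omega> in M. \<forall>n. f n \<omega> \<le> Z' \<omega>"
      using f(1) by (simp add: AE_all_countable)
    with lim show "AE \<omega> in M. Z \<omega> \<le> Z' \<omega>"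
      by eventually_elim (blast intro: LIMSEQ_le_const2)
  qed auto
  then show ess: "is_ess_sup M H (ess_sup M H)"
    unfolding ess_sup_def by (rule someI[of "is_ess_sup M H"])
  have [measurable]: "ess_sup M H \<in> borel_measurable M"
    using ess by (simp add: is_ess_sup_def)
  have eq: "AE \<omega> in M. Z \<omega> = ess_sup M H \<omega>"
    using \<open>is_ess_sup M H Z\<close> ess by (rule is_ess_sup_unique)
  then show "integrable M (ess_sup M H)"
    using intZ integrable_cong_AE[OF _ _ eq] by simp
  have "integral\<^sup>L M (ess_sup M H) = s"
    using integral_cong_AE[OF _ _ eq] Zs by simp
  then show "\<exists>h\<in>H. (\<integral>\<omega>. ess_sup M H \<omega> \<partial>M) \<le> (\<integral>\<omega>. h \<omega> \<partial>M) + e" if "e > 0"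
    proof -
    obtain h where "h \<in> H" "s - e < integral\<^sup>L M h"
      using approx[OF \<open>e > 0\<close>] by blast
    with \<open>integral\<^sup>L M (ess_sup M H) = s\<close> show ?thesis
      by (intro bexI[of _ h]) auto
  qed
qed

lemma ess_sup_eqI:
  assumes "is_ess_sup M H Z"
  shows "AE \<omega> in M. Z \<omega> = ess_sup M H \<omega>"
  using is_ess_sup_unique[OF assms] someI[of "is_ess_sup M H", OF assms]
  by (simp add: ess_sup_def)

section \<open>Finite approximation of times from the right\<close>

text \<open>Enumerates some countable dense set of times; only its density matters. Indexing by
  naturals makes set operations over dense times countable and provides finite initial segments as
  grids.\<close>

definition dense_time :: "nat \<Rightarrow> ennreal" where
  "dense_time = from_nat_into (SOME D. countable D \<and> (\<forall>U. open U \<longrightarrow> U \<noteq> {} \<longrightarrow> (\<exists>d\<in>D. d \<in> U)))"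

lemma dense_time_between:
  assumes "s < (u::ennreal)"
  obtains i where "s < dense_time i" "dense_time i < u"
proof -
  let ?P = "\<lambda>D::ennreal set. countable D \<and> (\<forall>U. open U \<longrightarrow> U \<noteq> {} \<longrightarrow> (\<exists>d\<in>D. d \<in> U))"
  define D where "D = (SOME D. ?P D)"
  have "\<exists>D. ?P D"
    by (metis countable_dense_setE)
  then have D: "?P D"
    unfolding D_def by (rule someI_ex)
  moreover obtain x where "s < x" "x < u"
    using dense[OF assms] by blast
  ultimately obtain d where d: "d \<in> D" "d \<in> {s<..<u}"
    by (metis empty_iff greaterThanLessThan_iff open_greaterThanLessThan)
  with D obtain i where "dense_time i = d"
    unfolding dense_time_def D_def[symmetric] using from_nat_into_surj by metis
  with d that show thesis
    by auto
qed

definition grid :: "nat \<Rightarrow> ennreal set" where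
  "grid k = insert \<top> (dense_time ` {..k})"

text \<open>The next grid point strictly to the right. The point \<open>\<top>\<close>, which
  belongs to every grid, catches the times that have no other grid point after them. Strictness
  means that an approximation of a time \<open>t \<ge> a\<close> falls strictly after
  \<open>a\<close>.\<close>

definition disc :: "nat \<Rightarrow> ennreal \<Rightarrow> ennreal" where
  "disc k s = Min {t\<in>grid k. s < t \<or> t = \<top>}"

lemma finite_grid [simp]: "finite (grid k)"
  by (simp add: grid_def)

lemma disc_mem: "disc k s \<in> {t\<in>grid k. s < t \<or> t = \<top>}"
  unfolding disc_def by (rule Min_in) (auto simp: grid_def)

lemma disc_in_grid [simp]: "disc k s \<in> grid k"
  using disc_mem by blast

lemma disc_greater: "s < \<top> \<Longrightarrow> s < disc k s"
  using disc_mem[of k s] by auto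

lemma disc_ge [simp]: "s \<le> disc k s"
  using disc_mem[of k s] by auto

lemma disc_le_iff: "disc k s \<le> t \<longleftrightarrow> (\<exists>u\<in>grid k. u \<le> t \<and> (s < u \<or> u = \<top>))"
  unfolding disc_def by (subst Min_le_iff) (auto simp: grid_def)

lemma disc_le: "i \<le> k \<Longrightarrow> s < dense_time i \<Longrightarrow> disc k s \<le> dense_time i"
  unfolding disc_le_iff by (auto simp: grid_def)

lemma disc_tendsto: "(\<lambda>k. disc k s) \<longlonglongrightarrow> s"
proof (rule order_tendstoI)
  fix a assume "a < s"
  then show "\<forall>\<^sub>F k in sequentially. a < disc k s"
    by (intro always_eventually allI) (rule less_le_trans[OF _ disc_ge])
next
  fix a assume "s < a"
  then obtain i where "s < dense_time i" "dense_time i < a"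
    by (rule dense_time_between)
  then show "\<forall>\<^sub>F k in sequentially. disc k s < a"
    using disc_le by (intro eventually_sequentiallyI[of i]) (meson le_less_trans)
qed

text \<open>The filter \<open>at_right s\<close> ignores members of the sequence equal to
  \<open>s\<close>, but their value is already the limit. At \<open>\<top>\<close>, where
  right-continuity is void, a sequence staying to the right is constant.\<close>

lemma right_limit_sequentially:
  fixes f :: "ennreal \<Rightarrow> 'b::topological_space"
  assumes f: "s < \<top> \<Longrightarrow> (f \<longlongrightarrow> f s) (at_right s)"
    and u: "u \<longlonglongrightarrow> s" "\<And>k::nat. s \<le> u k"
  shows "(\<lambda>k. f (u k)) \<longlonglongrightarrow> f s"
proof (cases "s < \<top>")
  case True
  show ?thesis
  proof (rule topological_tendstoI)
    fix S assume S: "open S" "f s \<in> S"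
    then have "\<forall>\<^sub>F t in at_right s. f t \<in> S"
      using f[OF True] by (auto simp: tendsto_def)
    then obtain b where b: "s < b" "\<And>t. s < t \<Longrightarrow> t < b \<Longrightarrow> f t \<in> S"
      using True by (auto simp: eventually_at_right)
    have "\<forall>\<^sub>F k in sequentially. u k < b"
      using u(1) b(1) by (rule order_tendstoD)
    then show "\<forall>\<^sub>F k in sequentially. f (u k) \<in> S"
    proof eventually_elim
      case (elim k)
      then show ?case
        using b(2)[of "u k"] u(2)[of k] S(2) by (cases "u k = s") auto
    qed
  qed
next
  case False
  then have "u k = s" for k
    using u(2)[of k] by (metis less_top top_unique)
  then show ?thesis
    by simp
qed

lemma measurable_disc:
  assumes [measurable]: "\<tau> \<in> borel_measurable M"
  shows "(\<lambda>\<omega>. disc k (\<tau> \<omega>)) \<in> borel_measurable M"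
proof (rule borel_measurableI_le)
  fix t
  have "{\<omega> \<in> space M. disc k (\<tau> \<omega>) \<le> t} =
      (\<Union>u\<in>{u\<in>grid k. u \<le> t}. {\<omega> \<in> space M. \<tau> \<omega> < u \<or> u = \<top>})"
    by (auto simp: disc_le_iff)
  also have "\<dots> \<in> sets M"
    by (intro sets.finite_UN) auto
  finally show "{\<omega> \<in> space M. disc k (\<tau> \<omega>) \<le> t} \<in> sets M" .
qed

text \<open>Replaces the substitution of a random time by a finite sum over fixed times.
  Measurability of \<open>f\<close> in \<open>\<omega>\<close> for each fixed time is then enough,
  and right-continuity carries it over to general random times.\<close>

lemma process_at_disc:
  fixes f :: "ennreal \<Rightarrow> 'a \<Rightarrow> real"
  shows "f (disc k s) \<omega> = (\<Sum>t\<in>grid k. if disc k s = t then f t \<omega> else 0)"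
  by simp

lemma measurable_process_at:
  fixes f :: "ennreal \<Rightarrow> 'a \<Rightarrow> real"
  assumes f[measurable]: "\<And>t. f t \<in> borel_measurable M"
    and rc: "right_continuous_process M f"
    and \<tau>[measurable]: "\<tau> \<in> borel_measurable M"
  shows "(\<lambda>\<omega>. f (\<tau> \<omega>) \<omega>) \<in> borel_measurable M"
proof (rule borel_measurable_LIMSEQ_real)
  fix \<omega> assume "\<omega> \<in> space M"
  then show "(\<lambda>k. f (disc k (\<tau> \<omega>)) \<omega>) \<longlonglongrightarrow> f (\<tau> \<omega>) \<omega>"
    using rc by (intro right_limit_sequentially[where f="\<lambda>t. f t \<omega>"] disc_tendsto disc_ge)
      (auto simp: right_continuous_process_def)
next
  fix k
  note [measurable] = measurable_disc[OF \<tau>, of k]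
  show "(\<lambda>\<omega>. f (disc k (\<tau> \<omega>)) \<omega>) \<in> borel_measurable M"
    unfolding process_at_disc by measurable
qed

lemma eq_infinityI: "\<not> t < \<infinity> \<Longrightarrow> t = (\<infinity>::ennreal)"
  by (metis infinity_ennreal_def less_top)

section \<open>Entry times\<close>

lemma entry_after_at: "entry_after X D \<tau> \<omega> = entry_after X D (\<lambda>_. \<tau> \<omega>) \<omega>"
  by (simp add: entry_after_def)

lemma entry_after_ge: "\<tau> \<omega> \<le> entry_after X D \<tau> \<omega>"
  unfolding entry_after_def by (rule Inf_greatest) auto

lemma entry_after_mono: "\<tau> \<omega> \<le> \<tau>' \<omega> \<Longrightarrow> entry_after X D \<tau> \<omega> \<le> entry_after X D \<tau>' \<omega>"
  unfolding entry_after_def by (rule Inf_superset_mono) auto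

lemma entry_after_less_iff:
  "entry_after X D \<tau> \<omega> < t \<longleftrightarrow> (\<exists>u. \<tau> \<omega> < u \<and> u < \<infinity> \<and> X u \<omega> \<in> D \<and> u < t)"
  unfolding entry_after_def by (auto simp: Inf_less_iff)

text \<open>Right-continuity in the starting point comes from the strict inequality in the entry
  time: a visit at \<open>v > \<tau> \<omega>\<close> counts from every starting point below
  \<open>v\<close>.\<close>

lemma entry_after_tendsto:
  assumes u: "u \<longlonglongrightarrow> \<tau> \<omega>" "\<And>k::nat. \<tau> \<omega> \<le> u k"
  shows "(\<lambda>k. entry_after X D (\<lambda>_. u k) \<omega>) \<longlonglongrightarrow> entry_after X D \<tau> \<omega>"
proof (rule order_tendstoI)
  fix a assume "a < entry_after X D \<tau> \<omega>"
  also have "\<dots> \<le> entry_after X D (\<lambda>_. u k) \<omega>" for k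
    using u(2) by (rule entry_after_mono)
  finally show "\<forall>\<^sub>F k in sequentially. a < entry_after X D (\<lambda>_. u k) \<omega>"
    by auto
next
  fix a assume "entry_after X D \<tau> \<omega> < a"
  then obtain v where v: "\<tau> \<omega> < v" "v < \<infinity>" "X v \<omega> \<in> D" "v < a"
    by (auto simp: entry_after_less_iff)
  have "\<forall>\<^sub>F k in sequentially. u k < v"
    using u(1) v(1) by (rule order_tendstoD)
  then show "\<forall>\<^sub>F k in sequentially. entry_after X D (\<lambda>_. u k) \<omega> < a"
    by eventually_elim (use v in \<open>auto simp: entry_after_less_iff\<close>)
qed

section \<open>The setting, and stopping times under the usual conditions\<close>

definition payoff :: "(ennreal \<Rightarrow> 'a \<Rightarrow> real) \<Rightarrow> nat \<Rightarrow> (nat \<Rightarrow> 'a \<Rightarrow> ennreal) \<Rightarrow> 'a \<Rightarrow> real" where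
  "payoff Y m \<tau> \<omega> = (\<Sum>i=1..m. Y (\<tau> i \<omega>) \<omega>)"

text \<open>Only the filtration and the reward are fixed. The sets to be visited stay variable
  because the recursion passes from \<open>B\<close> to its shift
  \<open>\<lambda>i. B (Suc i)\<close>.\<close>

locale reward_process = prob_space M
  for M :: "'a measure" and F :: "ennreal \<Rightarrow> 'a measure" and Y :: "ennreal \<Rightarrow> 'a \<Rightarrow> real" +
  assumes usual: "usual_filtration M F"
    and adapted: "adapted_process F Y"
    and right_cont: "right_continuous_process M Y"
    and nonneg: "\<forall>t<\<infinity>. \<forall>\<omega>\<in>space M. 0 \<le> Y t \<omega>"
    and sup_finite: "(\<integral>\<^sup>+\<omega>. (SUP t\<in>{..<\<infinity>}. ennreal (Y t \<omega>)) \<partial>M) < \<infinity>"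
    and limsup: "limsup_at_infinity M Y"
begin

sublocale filtration "space M" F
  using usual by (simp add: usual_filtration_def)

lemma
  shows sets_F_finite_subset: "t < \<infinity> \<Longrightarrow> sets (F t) \<subseteq> sets M"
    and sets_F_right_cont: "t < \<infinity> \<Longrightarrow> sets (F t) = (\<Inter>u\<in>{t<..<\<infinity>}. sets (F u))"
    and null_sets_F_0: "null_sets M \<subseteq> sets (F 0)"
    and sets_F_infinity: "sets (F \<infinity>) = sigma_sets (space M) (\<Union>t\<in>{..<\<infinity>}. sets (F t))"
  using usual unfolding usual_filtration_def by blast+

lemma sets_F_subset: "sets (F t) \<subseteq> sets M"
proof (cases "t < \<infinity>")
  case True
  then show ?thesis
    by (rule sets_F_finite_subset)
next
  case False
  then have t: "t = \<infinity>"
    by (rule eq_infinityI)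
  have "(\<Union>t\<in>{..<\<infinity>}. sets (F t)) \<subseteq> sets M"
    using sets_F_finite_subset by auto
  then have "sigma_sets (space M) (\<Union>t\<in>{..<\<infinity>}. sets (F t)) \<subseteq> sets M"
    by (rule sets.sigma_sets_subset)
  then show ?thesis
    by (simp only: t sets_F_infinity)
qed

lemma measurable_F_imp: "f \<in> measurable (F t) N \<Longrightarrow> f \<in> measurable M N"
  by (rule measurable_from_subalg[of M "F t"]) (auto simp: subalgebra_def space_F sets_F_subset)

lemma null_sets_F: "N \<in> null_sets M \<Longrightarrow> N \<in> sets (F t)"
  using null_sets_F_0 sets_F_mono[of 0 t] by auto

lemma stopping_time_measurable: "stopping_time F \<tau> \<Longrightarrow> \<tau> \<in> borel_measurable M"
  using measurable_stopping_time sets_F_subset space_F by metis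

lemma sets_pre_sigma_F: "stopping_time F \<sigma> \<Longrightarrow> A \<in> sets (pre_sigma \<sigma>) \<Longrightarrow> A \<in> sets (F \<infinity>)"
  using sets_pre_sigmaD[of \<sigma> A \<infinity>] by simp

lemma sets_pre_sigma_M: "stopping_time F \<sigma> \<Longrightarrow> A \<in> sets (pre_sigma \<sigma>) \<Longrightarrow> A \<in> sets M"
  using sets_pre_sigma_F sets_F_subset by blast

lemma subalgebra_pre_sigma: "stopping_time F \<sigma> \<Longrightarrow> subalgebra M (pre_sigma \<sigma>)"
  by (auto simp: subalgebra_def space_pre_sigma sets_pre_sigma_M)

lemma finite_measure_subalgebra_pre_sigma:
  "stopping_time F \<sigma> \<Longrightarrow> finite_measure_subalgebra M (pre_sigma \<sigma>)"
  by (intro finite_measure_subalgebra.intro finite_measure_axioms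
      finite_measure_subalgebra_axioms.intro subalgebra_pre_sigma)

lemma finite_measure_subalgebra_F: "finite_measure_subalgebra M (F t)"
  by (intro finite_measure_subalgebra.intro finite_measure_axioms
      finite_measure_subalgebra_axioms.intro) (auto simp: subalgebra_def space_F sets_F_subset)

text \<open>For \<open>u < t\<close> the event \<open>{\<sigma> \<le> u}\<close> misses
  \<open>A\<close>. It is applied with \<open>\<sigma>\<close> the entry time after
  \<open>t\<close>: events of \<open>F t\<close> may then be used to test the value at that entry
  time.\<close>

lemma sets_F_pre_sigma:
  assumes \<sigma>: "stopping_time F \<sigma>" and A: "A \<in> sets (F t)" and le: "\<And>\<omega>. \<omega> \<in> A \<Longrightarrow> t \<le> \<sigma> \<omega>"
  shows "A \<in> sets (pre_sigma \<sigma>)"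
proof (rule sets_pre_sigmaI[OF \<sigma>])
  fix u
  show "{\<omega> \<in> A. \<sigma> \<omega> \<le> u} \<in> sets (F u)"
  proof (cases "t \<le> u")
    case True
    have "A \<inter> {\<omega> \<in> space (F u). \<sigma> \<omega> \<le> u} \<in> sets (F u)"
      using sets_F_mono[OF True] A stopping_timeD[OF \<sigma>, of u] by (auto simp: pred_def)
    also have "A \<inter> {\<omega> \<in> space (F u). \<sigma> \<omega> \<le> u} = {\<omega> \<in> A. \<sigma> \<omega> \<le> u}"
      using sets.sets_into_space[OF A] by (auto simp: space_F)
    finally show ?thesis .
  next
    case False
    then have "{\<omega> \<in> A. \<sigma> \<omega> \<le> u} = {}"
      using le by fastforce
    then show ?thesis
      by (metis sets.empty_sets)
  qed
qed

lemma stopping_time_less_F: "stopping_time F \<tau> \<Longrightarrow> {\<omega> \<in> space M. \<tau> \<omega> < t} \<in> sets (F t)"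
  using stopping_time_less_const[of \<tau> t] by (simp add: pred_def space_F)

text \<open>Here the right-continuity of the filtration enters.\<close>
lemma stopping_timeI_less:
  assumes less: "\<And>t. t < \<infinity> \<Longrightarrow> {\<omega> \<in> space M. \<tau> \<omega> < t} \<in> sets (F t)"
  shows "stopping_time F \<tau>"
proof (rule stopping_timeI)
  fix t :: ennreal
  show "Measurable.pred (F t) (\<lambda>\<omega>. \<tau> \<omega> \<le> t)"
  proof (cases "t < \<infinity>")
    case True
    have "{\<omega> \<in> space M. \<tau> \<omega> \<le> t} \<in> sets (F u)" if u: "t < u" "u < \<infinity>" for u
    proof -
      let ?I = "{i. t < dense_time i \<and> dense_time i < u}"
      \<comment> \<open>Dense times between \<open>t\<close> and \<open>u\<close> already force
        \<open>\<tau> \<omega> \<le> t\<close>, and restricting to them keeps every set of the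
        intersection in \<open>F u\<close>.\<close>
      have "{\<omega> \<in> space M. \<tau> \<omega> \<le> t} =
          (\<Inter>i\<in>?I. {\<omega> \<in> space M. \<tau> \<omega> < dense_time i})" (is "?L = ?R")
      proof
        show "?L \<subseteq> ?R"
          by auto
        show "?R \<subseteq> ?L"
        proof
          fix \<omega> assume \<omega>: "\<omega> \<in> ?R"
          obtain i where i: "t < dense_time i" "dense_time i < u"
            using dense_time_between[OF u(1)] by blast
          have "\<tau> \<omega> \<le> t"
          proof (rule ccontr)
            assume "\<not> \<tau> \<omega> \<le> t"
            then have "t < min u (\<tau> \<omega>)"
              using u(1) by simp
            then obtain j where "t < dense_time j" "dense_time j < min u (\<tau> \<omega>)"
              by (rule dense_time_between)
            with \<omega> show False
              by fastforce
          qed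
          with \<omega> i show "\<omega> \<in> ?L"
            by auto
        qed
      qed
      also have "\<dots> \<in> sets (F u)"
      proof (rule sets.countable_INT')
        show "?I \<noteq> {}"
          using dense_time_between[OF u(1)] by blast
        have "{\<omega> \<in> space M. \<tau> \<omega> < dense_time i} \<in> sets (F u)" if "i \<in> ?I" for i
        proof -
          have "dense_time i < \<infinity>"
            using that u by (auto intro: less_trans)
          then show ?thesis
            using less[of "dense_time i"] that sets_F_mono[of "dense_time i" u] by (auto intro: less_imp_le)
        qed
        then show "(\<lambda>i. {\<omega> \<in> space M. \<tau> \<omega> < dense_time i}) ` ?I \<subseteq> sets (F u)"
          by auto
      qed auto
      finally show ?thesis .
    qed
    then have "{\<omega> \<in> space M. \<tau> \<omega> \<le> t} \<in> sets (F t)"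
      using sets_F_right_cont[OF True] by auto
    then show ?thesis
      by (simp add: pred_def space_F)
  next
    case False
    then have "t = \<infinity>"
      by (rule eq_infinityI)
    then show ?thesis
      by simp
  qed
qed

text \<open>The hypothesis speaks of deterministic starting times only. A dense time placed between
  \<open>\<tau> \<omega>\<close> and a visit before \<open>t\<close> can take over as the starting
  time, so the event becomes a countable union of events known by time \<open>t\<close>.\<close>

lemma stopping_time_entry_after:
  assumes D: "\<And>s. stopping_time F (entry_after X D (\<lambda>_. s))" and \<tau>: "stopping_time F \<tau>"
  shows "stopping_time F (entry_after X D \<tau>)"
proof (rule stopping_timeI_less)
  fix t :: ennreal
  let ?A = "\<lambda>i. {\<omega> \<in> space M. \<tau> \<omega> < dense_time i} \<inter>
    {\<omega> \<in> space M. entry_after X D (\<lambda>_. dense_time i) \<omega> < t}"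
  have "{\<omega> \<in> space M. entry_after X D \<tau> \<omega> < t} = (\<Union>i\<in>{i. dense_time i < t}. ?A i)" (is "?L = ?R")
  proof
    show "?L \<subseteq> ?R"
    proof
      fix \<omega> assume \<omega>: "\<omega> \<in> ?L"
      then obtain u where u: "\<tau> \<omega> < u" "u < \<infinity>" "X u \<omega> \<in> D" "u < t"
        by (auto simp: entry_after_less_iff)
      obtain i where i: "\<tau> \<omega> < dense_time i" "dense_time i < u"
        using u(1) by (rule dense_time_between)
      then have "\<omega> \<in> ?A i"
        using u \<omega> by (auto simp: entry_after_less_iff)
      then show "\<omega> \<in> ?R"
        using i u by (auto intro: less_trans)
    qed
    show "?R \<subseteq> ?L"
    proof
      fix \<omega> assume "\<omega> \<in> ?R"
      then obtain i where "\<omega> \<in> space M" "\<tau> \<omega> < dense_time i" "entry_after X D (\<lambda>_. dense_time i) \<omega> < t"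
        by auto
      then show "\<omega> \<in> ?L"
        using entry_after_mono[of \<tau> \<omega> "\<lambda>_. dense_time i" X D] by (auto intro: le_less_trans less_imp_le)
    qed
  qed
  also have "\<dots> \<in> sets (F t)"
  proof (rule sets.countable_UN'')
    fix i assume "i \<in> {i. dense_time i < t}"
    then show "?A i \<in> sets (F t)"
      using stopping_time_less_F[OF \<tau>, of "dense_time i"] sets_F_mono[of "dense_time i" t]
        stopping_time_less_F[OF D, of "dense_time i" t]
      by (intro sets.Int) (auto intro: less_imp_le)
  qed auto
  finally show "{\<omega> \<in> space M. entry_after X D \<tau> \<omega> < t} \<in> sets (F t)" .
qed

lemma stopping_time_disc:
  assumes \<tau>: "stopping_time F \<tau>"
  shows "stopping_time F (\<lambda>\<omega>. disc k (\<tau> \<omega>))"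
proof (rule stopping_timeI)
  fix t
  have "{\<omega> \<in> space M. disc k (\<tau> \<omega>) \<le> t} =
      (\<Union>u\<in>{u\<in>grid k. u \<le> t}. if u = \<top> then space M else {\<omega> \<in> space M. \<tau> \<omega> < u})"
    by (auto simp: disc_le_iff split: if_splits)
  also have "\<dots> \<in> sets (F t)"
  proof (intro sets.finite_UN)
    fix u assume u: "u \<in> {u\<in>grid k. u \<le> t}"
    have "{\<omega> \<in> space M. \<tau> \<omega> < u} \<in> sets (F t)"
      using stopping_time_less_F[OF \<tau>, of u] sets_F_mono[of u t] u by auto
    moreover have "space M \<in> sets (F t)"
      using sets.top[of "F t"] by (simp add: space_F)
    ultimately show "(if u = \<top> then space M else {\<omega> \<in> space M. \<tau> \<omega> < u}) \<in> sets (F t)"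
      by simp
  qed auto
  finally show "Measurable.pred (F t) (\<lambda>\<omega>. disc k (\<tau> \<omega>) \<le> t)"
    by (simp add: pred_def space_F)
qed

text \<open>If either time has occurred by \<open>t\<close>, then so has \<open>\<rho>\<close>, and
  hence it is known at \<open>t\<close> whether \<open>A\<close> holds.\<close>

lemma stopping_time_paste:
  assumes \<rho>: "stopping_time F \<rho>" and A: "A \<in> sets (pre_sigma \<rho>)"
    and \<tau>: "stopping_time F \<tau>" "\<And>\<omega>. \<omega> \<in> space M \<Longrightarrow> \<rho> \<omega> \<le> \<tau> \<omega>"
    and \<tau>': "stopping_time F \<tau>'" "\<And>\<omega>. \<omega> \<in> space M \<Longrightarrow> \<rho> \<omega> \<le> \<tau>' \<omega>"
  shows "stopping_time F (\<lambda>\<omega>. if \<omega> \<in> A then \<tau> \<omega> else \<tau>' \<omega>)"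
proof (rule stopping_timeI)
  fix t
  have A': "space M - A \<in> sets (pre_sigma \<rho>)"
    using sets.compl_sets[OF A] by (simp add: space_pre_sigma)
  have "{\<omega> \<in> A. \<rho> \<omega> \<le> t} \<inter> {\<omega> \<in> space (F t). \<tau> \<omega> \<le> t} \<union>
      {\<omega> \<in> space M - A. \<rho> \<omega> \<le> t} \<inter> {\<omega> \<in> space (F t). \<tau>' \<omega> \<le> t} \<in> sets (F t)"
    using sets_pre_sigmaD[OF \<rho> A] sets_pre_sigmaD[OF \<rho> A'] stopping_timeD[OF \<tau>(1)] stopping_timeD[OF \<tau>'(1)]
    by (intro sets.Un sets.Int) (auto simp: pred_def)
  also have "{\<omega> \<in> A. \<rho> \<omega> \<le> t} \<inter> {\<omega> \<in> space (F t). \<tau> \<omega> \<le> t} \<union>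
      {\<omega> \<in> space M - A. \<rho> \<omega> \<le> t} \<inter> {\<omega> \<in> space (F t). \<tau>' \<omega> \<le> t} = {\<omega> \<in> space M. (if \<omega> \<in> A then \<tau> \<omega> else \<tau>' \<omega>) \<le> t}"
    using \<tau>(2) \<tau>'(2) sets.sets_into_space[OF A]
    by (auto simp: space_F space_pre_sigma intro: order_trans)
  finally show "Measurable.pred (F t) (\<lambda>\<omega>. (if \<omega> \<in> A then \<tau> \<omega> else \<tau>' \<omega>) \<le> t)"
    by (simp add: pred_def space_F)
qed

section \<open>The dominating variable\<close>

text \<open>\<open>enn2real\<close> turns an infinite supremum into 0, so this bounds
  \<open>Y\<close> only outside a null set.\<close>

definition dom :: "'a \<Rightarrow> real" where
  "dom \<omega> = enn2real (SUP t\<in>{..<\<infinity>}. ennreal (Y t \<omega>))"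

lemma measurable_Y_finite: "t < \<infinity> \<Longrightarrow> Y t \<in> borel_measurable M"
  using adapted measurable_F_imp[of "Y t" t] by (auto simp: adapted_process_def)

text \<open>By right-continuity \<open>Y t\<close> is a limit of values at dense times after
  \<open>t\<close>. The map \<open>g\<close> covers the two scales in use: \<open>ennreal\<close>
  for the dominating variable and \<open>ereal\<close> for the upper limit at infinity.\<close>

lemma Y_le_countable_sup:
  fixes g :: "real \<Rightarrow> 'c::{complete_linorder, linorder_topology}"
  assumes \<omega>: "\<omega> \<in> space M" and t: "a \<le> t" "t < \<infinity>" and g: "continuous_on UNIV g"
  shows "g (Y t \<omega>) \<le> (SUP i\<in>{i. a < dense_time i \<and> dense_time i < \<infinity>}. g (Y (dense_time i) \<omega>))"
proof (rule LIMSEQ_le_const2)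
  have "(\<lambda>k. Y (disc k t) \<omega>) \<longlonglongrightarrow> Y t \<omega>"
    using right_cont \<omega> by (intro right_limit_sequentially[where f="\<lambda>t. Y t \<omega>"] disc_tendsto disc_ge)
      (auto simp: right_continuous_process_def)
  then show "(\<lambda>k. g (Y (disc k t) \<omega>)) \<longlonglongrightarrow> g (Y t \<omega>)"
    using g by (auto simp: continuous_on_def intro: tendsto_compose)
  have "\<forall>\<^sub>F k in sequentially. disc k t < \<infinity>"
    using disc_tendsto t(2) by (rule order_tendstoD)
  then have "\<forall>\<^sub>F k in sequentially. g (Y (disc k t) \<omega>) \<le>
      (SUP i\<in>{i. a < dense_time i \<and> dense_time i < \<infinity>}. g (Y (dense_time i) \<omega>))"
  proof eventually_elim
    case (elim k)
    then obtain i where i: "disc k t = dense_time i"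
      using disc_in_grid[of k t] by (auto simp: grid_def)
    have "a < disc k t"
      using t(1) disc_greater[of t k] t(2) by (metis infinity_ennreal_def le_less_trans)
    then show ?case
      using elim by (auto simp: i intro!: SUP_upper)
  qed
  then show "\<exists>N. \<forall>k\<ge>N. g (Y (disc k t) \<omega>) \<le>
      (SUP i\<in>{i. a < dense_time i \<and> dense_time i < \<infinity>}. g (Y (dense_time i) \<omega>))"
    by (simp add: eventually_sequentially)
qed

lemma sup_measurable: "(\<lambda>\<omega>. SUP t\<in>{..<\<infinity>}. ennreal (Y t \<omega>)) \<in> borel_measurable M"
proof -
  let ?I = "{i. 0 < dense_time i \<and> dense_time i < \<infinity>}"
  have eq: "(SUP t\<in>{..<\<infinity>}. ennreal (Y t \<omega>)) = (SUP i\<in>?I. ennreal (Y (dense_time i) \<omega>))"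
    if "\<omega> \<in> space M" for \<omega>
  proof (rule antisym)
    show "(SUP t\<in>{..<\<infinity>}. ennreal (Y t \<omega>)) \<le> (SUP i\<in>?I. ennreal (Y (dense_time i) \<omega>))"
      using that by (intro SUP_least Y_le_countable_sup) (auto intro: continuous_on_ennreal)
    show "(SUP i\<in>?I. ennreal (Y (dense_time i) \<omega>)) \<le> (SUP t\<in>{..<\<infinity>}. ennreal (Y t \<omega>))"
      by (intro SUP_least SUP_upper) auto
  qed
  have "(\<lambda>\<omega>. SUP i\<in>?I. ennreal (Y (dense_time i) \<omega>)) \<in> borel_measurable M"
    using measurable_Y_finite by (intro borel_measurable_SUP measurable_compose[OF _ measurable_ennreal]) auto
  then show ?thesis
    using eq by (subst measurable_cong) auto
qed

lemma sup_AE_finite: "AE \<omega> in M. (SUP t\<in>{..<\<infinity>}. ennreal (Y t \<omega>)) < \<infinity>"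
proof -
  have "AE \<omega> in M. (SUP t\<in>{..<\<infinity>}. ennreal (Y t \<omega>)) \<noteq> \<infinity>"
    using sup_finite by (intro nn_integral_PInf_AE[OF sup_measurable]) auto
  then show ?thesis
    by eventually_elim (rule ccontr, drule eq_infinityI, erule notE)
qed

lemma integrable_dom: "integrable M dom"
proof (rule integrableI_nonneg)
  show "dom \<in> borel_measurable M"
    unfolding dom_def using sup_measurable by measurable
  show "AE \<omega> in M. 0 \<le> dom \<omega>"
    by (simp add: dom_def)
  have "(\<integral>\<^sup>+\<omega>. ennreal (dom \<omega>) \<partial>M) = (\<integral>\<^sup>+\<omega>. (SUP t\<in>{..<\<infinity>}. ennreal (Y t \<omega>)) \<partial>M)"
    using sup_AE_finite by (intro nn_integral_cong_AE) (auto simp: dom_def elim: eventually_mono)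
  then show "(\<integral>\<^sup>+\<omega>. ennreal (dom \<omega>) \<partial>M) < \<infinity>"
    using sup_finite by simp
qed

text \<open>Integers are cofinal below infinity. The outer infimum thus becomes countable, and with
  \<open>Y_le_countable_sup\<close> so does the inner supremum, which makes
  \<open>Y \<infinity>\<close> measurable.\<close>

lemma limsup_eq:
  fixes f :: "ennreal \<Rightarrow> ereal"
  shows "Limsup (at_left \<infinity>) f = (INF n::nat. SUP t\<in>{of_nat n<..<\<infinity>}. f t)"
proof (rule antisym)
  show "Limsup (at_left \<infinity>) f \<le> (INF n::nat. SUP t\<in>{of_nat n<..<\<infinity>}. f t)"
  proof (rule INF_greatest)
    fix n :: nat
    have "\<forall>\<^sub>F t in at_left \<infinity>. f t \<le> (SUP t\<in>{of_nat n<..<\<infinity>}. f t)"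
      by (subst eventually_at_left[of 0]) (auto intro!: exI[of _ "of_nat n"] SUP_upper simp: of_nat_less_top)
    then show "Limsup (at_left \<infinity>) f \<le> (SUP t\<in>{of_nat n<..<\<infinity>}. f t)"
      by (rule Limsup_bounded)
  qed
  show "(INF n::nat. SUP t\<in>{of_nat n<..<\<infinity>}. f t) \<le> Limsup (at_left \<infinity>) f"
    unfolding Limsup_def
  proof (rule INF_greatest)
    fix P assume "P \<in> {P. eventually P (at_left (\<infinity>::ennreal))}"
    then obtain b where b: "b < \<infinity>" "\<And>t. b < t \<Longrightarrow> t < \<infinity> \<Longrightarrow> P t"
      by (auto simp: eventually_at_left[of 0])
    obtain n :: nat where n: "b < of_nat n"
      using b(1) ennreal_Ex_less_of_nat[of b] by auto
    have "(SUP t\<in>{of_nat n<..<\<infinity>}. f t) \<le> Sup (f ` Collect P)"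
      using b(2) less_trans[OF n] by (intro SUP_subset_mono) auto
    then show "(INF n::nat. SUP t\<in>{of_nat n<..<\<infinity>}. f t) \<le> Sup (f ` Collect P)"
      by (rule order_trans[OF INF_lower[OF UNIV_I]])
  qed
qed

lemma Y_infinity:
  "\<omega> \<in> space M \<Longrightarrow> Y \<infinity> \<omega> = real_of_ereal (Limsup (at_left \<infinity>) (\<lambda>t. ereal (Y t \<omega>)))"
  using limsup unfolding limsup_at_infinity_def by blast

lemma measurable_Y_infinity: "Y \<infinity> \<in> borel_measurable M"
proof -
  let ?I = "\<lambda>n::nat. {i. of_nat n < dense_time i \<and> dense_time i < \<infinity>}"
  have eq: "(SUP t\<in>{of_nat n<..<\<infinity>}. ereal (Y t \<omega>)) = (SUP i\<in>?I n. ereal (Y (dense_time i) \<omega>))"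
    if "\<omega> \<in> space M" for \<omega> and n :: nat
  proof (rule antisym)
    show "(SUP t\<in>{of_nat n<..<\<infinity>}. ereal (Y t \<omega>)) \<le> (SUP i\<in>?I n. ereal (Y (dense_time i) \<omega>))"
      using that by (intro SUP_least Y_le_countable_sup) (auto intro: continuous_on_ereal)
    show "(SUP i\<in>?I n. ereal (Y (dense_time i) \<omega>)) \<le> (SUP t\<in>{of_nat n<..<\<infinity>}. ereal (Y t \<omega>))"
      by (intro SUP_least SUP_upper) auto
  qed
  have "(\<lambda>\<omega>. real_of_ereal (INF n. SUP i\<in>?I n. ereal (Y (dense_time i) \<omega>))) \<in> borel_measurable M"
    using measurable_Y_finite by (intro borel_measurable_real_of_ereal borel_measurable_INF borel_measurable_SUP
        borel_measurable_ereal) auto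
  then show ?thesis
    using eq by (subst measurable_cong) (simp_all only: Y_infinity limsup_eq)
qed

lemma measurable_Y [measurable]: "Y t \<in> borel_measurable M"
  using measurable_Y_finite measurable_Y_infinity eq_infinityI by metis

lemma Y_nonneg:
  assumes \<omega>: "\<omega> \<in> space M"
  shows "0 \<le> Y t \<omega>"
proof (cases "t < \<infinity>")
  case True
  then show ?thesis
    using nonneg \<omega> by auto
next
  case False
  have "0 \<le> Limsup (at_left \<infinity>) (\<lambda>t. ereal (Y t \<omega>))"
    unfolding limsup_eq
  proof (rule INF_greatest)
    fix n :: nat
    have "(of_nat n :: ennreal) < \<infinity>"
      by (simp add: of_nat_less_top)
    then obtain t :: ennreal where t: "of_nat n < t" "t < \<infinity>"
      using dense[of "of_nat n" \<infinity>] by blast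
    have "0 \<le> ereal (Y t \<omega>)"
      using nonneg \<omega> t by auto
    also have "\<dots> \<le> (SUP t\<in>{of_nat n<..<\<infinity>}. ereal (Y t \<omega>))"
      using t by (intro SUP_upper) auto
    finally show "0 \<le> (SUP t\<in>{of_nat n<..<\<infinity>}. ereal (Y t \<omega>))" .
  qed
  then show ?thesis
    unfolding eq_infinityI[OF False] Y_infinity[OF \<omega>] by (rule real_of_ereal_pos)
qed

text \<open>One null set serves all times at once, infinity included; this is what permits
  substituting random times.\<close>

lemma Y_le_dom: "AE \<omega> in M. \<forall>t. Y t \<omega> \<le> dom \<omega>"
  using sup_AE_finite AE_space
proof eventually_elim
  case (elim \<omega>)
  have fin: "Y t \<omega> \<le> dom \<omega>" if "t < \<infinity>" for t
  proof -
    have "ennreal (Y t \<omega>) \<le> (SUP t\<in>{..<\<infinity>}. ennreal (Y t \<omega>))"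
      using that by (intro SUP_upper) auto
    then have "enn2real (ennreal (Y t \<omega>)) \<le> dom \<omega>"
      unfolding dom_def using elim(1) by (intro enn2real_mono) auto
    then show ?thesis
      using Y_nonneg[OF elim(2)] by simp
  qed
  have "Y \<infinity> \<omega> \<le> dom \<omega>"
  proof -
    have "Limsup (at_left \<infinity>) (\<lambda>t. ereal (Y t \<omega>)) \<le> ereal (dom \<omega>)"
      unfolding limsup_eq using fin by (intro INF_lower2[of 0] SUP_least) auto
    moreover have "0 \<le> dom \<omega>"
      by (simp add: dom_def)
    ultimately have "real_of_ereal (Limsup (at_left \<infinity>) (\<lambda>t. ereal (Y t \<omega>))) \<le> dom \<omega>"
      by (cases "Limsup (at_left \<infinity>) (\<lambda>t. ereal (Y t \<omega>))") auto
    then show ?thesis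
      unfolding Y_infinity[OF elim(2)] .
  qed
  show ?case
  proof
    fix t
    show "Y t \<omega> \<le> dom \<omega>"
    proof (cases "t < \<infinity>")
      case False
      show ?thesis
        unfolding eq_infinityI[OF False] by fact
    qed (rule fin)
  qed
qed

lemma measurable_Y_at: "\<tau> \<in> borel_measurable M \<Longrightarrow> (\<lambda>\<omega>. Y (\<tau> \<omega>) \<omega>) \<in> borel_measurable M"
  by (rule measurable_process_at[OF measurable_Y right_cont])

lemma integrable_Y_at:
  assumes "stopping_time F \<tau>"
  shows "integrable M (\<lambda>\<omega>. Y (\<tau> \<omega>) \<omega>)"
proof (rule Bochner_Integration.integrable_bound[OF integrable_dom])
  show "(\<lambda>\<omega>. Y (\<tau> \<omega>) \<omega>) \<in> borel_measurable M"
    using assms by (rule measurable_Y_at[OF stopping_time_measurable])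
  show "AE \<omega> in M. norm (Y (\<tau> \<omega>) \<omega>) \<le> norm (dom \<omega>)"
    using Y_le_dom AE_space
  proof eventually_elim
    case (elim \<omega>)
    have "Y (\<tau> \<omega>) \<omega> \<le> dom \<omega>" "0 \<le> Y (\<tau> \<omega>) \<omega>"
      using elim Y_nonneg by auto
    then show ?case by simp
  qed
qed

lemma Y_at_tendsto:
  assumes "\<omega> \<in> space M" "u \<longlonglongrightarrow> s" "\<And>k::nat. s \<le> u k"
  shows "(\<lambda>k. Y (u k) \<omega>) \<longlonglongrightarrow> Y s \<omega>"
proof (rule right_limit_sequentially[where f="\<lambda>t. Y t \<omega>", OF _ assms(2,3)])
  show "s < \<top> \<Longrightarrow> ((\<lambda>t. Y t \<omega>) \<longlongrightarrow> Y s \<omega>) (at_right s)"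
    using right_cont assms(1) by (auto simp: right_continuous_process_def)
qed

section \<open>Tuples of stopping times\<close>

lemma multi_stopping_time:
  "\<tau> \<in> multi_stopping_times M F X m C \<sigma> \<Longrightarrow> i \<in> {1..m} \<Longrightarrow> stopping_time F (\<tau> i)"
  by (simp add: multi_stopping_times_def)

lemma multi_stopping_times_ge:
  assumes \<tau>: "\<tau> \<in> multi_stopping_times M F X m C \<sigma>" and \<omega>: "\<omega> \<in> space M" and i: "i \<in> {1..m}"
  shows "\<sigma> \<omega> \<le> \<tau> i \<omega>"
  using i
proof (induction i)
  case (Suc i)
  show ?case
  proof (cases "i = 0")
    case True
    then show ?thesis
      using \<tau> \<omega> by (simp add: multi_stopping_times_def)
  next
    case False
    then have i: "i \<in> {1..<m}"
      using Suc.prems by auto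
    then have "\<sigma> \<omega> \<le> \<tau> i \<omega>"
      using Suc.IH by auto
    also have "\<dots> \<le> entry_after X (C i) (\<tau> i) \<omega>"
      by (rule entry_after_ge)
    also have "\<dots> \<le> \<tau> (Suc i) \<omega>"
      using \<tau> \<omega> i by (auto simp: multi_stopping_times_def)
    finally show ?thesis .
  qed
qed simp

lemma multi_stopping_times_antimono:
  assumes "\<tau> \<in> multi_stopping_times M F X m C \<sigma>" "\<And>\<omega>. \<omega> \<in> space M \<Longrightarrow> \<sigma>' \<omega> \<le> \<sigma> \<omega>"
  shows "\<tau> \<in> multi_stopping_times M F X m C \<sigma>'"
  using assms by (auto simp: multi_stopping_times_def intro: order_trans)

text \<open>Keeps the families nonempty and fills up tuples outside an event, since infinity meets
  every lower bound.\<close>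

lemma infinity_in_multi_stopping_times: "(\<lambda>_ _. \<infinity>) \<in> multi_stopping_times M F X m C \<sigma>"
  by (auto simp: multi_stopping_times_def stopping_time_const)

text \<open>The constraints compare values at a single \<open>\<omega>\<close>, so pasting respects
  them; the condition that \<open>A\<close> is known at \<open>\<rho>\<close> serves the stopping
  property.\<close>

lemma multi_stopping_times_paste:
  assumes \<rho>: "stopping_time F \<rho>" and A: "A \<in> sets (pre_sigma \<rho>)"
    and \<tau>: "\<tau> \<in> multi_stopping_times M F X m C \<sigma>" "\<And>\<omega>. \<omega> \<in> space M \<Longrightarrow> \<rho> \<omega> \<le> \<sigma> \<omega>"
    and \<tau>': "\<tau>' \<in> multi_stopping_times M F X m C \<sigma>'" "\<And>\<omega>. \<omega> \<in> space M \<Longrightarrow> \<rho> \<omega> \<le> \<sigma>' \<omega>"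
  shows "(\<lambda>i \<omega>. if \<omega> \<in> A then \<tau> i \<omega> else \<tau>' i \<omega>) \<in>
    multi_stopping_times M F X m C (\<lambda>\<omega>. if \<omega> \<in> A then \<sigma> \<omega> else \<sigma>' \<omega>)"
  unfolding multi_stopping_times_def
proof (intro CollectI conjI ballI)
  fix i assume i: "i \<in> {1..m}"
  show "stopping_time F (\<lambda>\<omega>. if \<omega> \<in> A then \<tau> i \<omega> else \<tau>' i \<omega>)"
  proof (rule stopping_time_paste[OF \<rho> A])
    show "\<rho> \<omega> \<le> \<tau> i \<omega>" if "\<omega> \<in> space M" for \<omega>
      using \<tau>(2)[OF that] multi_stopping_times_ge[OF \<tau>(1) that i] by (rule order_trans)
    show "\<rho> \<omega> \<le> \<tau>' i \<omega>" if "\<omega> \<in> space M" for \<omega>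
      using \<tau>'(2)[OF that] multi_stopping_times_ge[OF \<tau>'(1) that i] by (rule order_trans)
  qed (use \<tau>(1) \<tau>'(1) i multi_stopping_time in blast)+
next
  fix \<omega> assume "\<omega> \<in> space M"
  then show "(if \<omega> \<in> A then \<sigma> \<omega> else \<sigma>' \<omega>) \<le> (if \<omega> \<in> A then \<tau> 1 \<omega> else \<tau>' 1 \<omega>)"
    using \<tau>(1) \<tau>'(1) by (auto simp: multi_stopping_times_def)
next
  fix i \<omega> assume "i \<in> {1..<m}" "\<omega> \<in> space M"
  then show "entry_after X (C i) (\<lambda>\<omega>. if \<omega> \<in> A then \<tau> i \<omega> else \<tau>' i \<omega>) \<omega> \<le>
      (if \<omega> \<in> A then \<tau> (Suc i) \<omega> else \<tau>' (Suc i) \<omega>)"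
    using \<tau>(1) \<tau>'(1) by (cases "\<omega> \<in> A") (auto simp: multi_stopping_times_def entry_after_def)
qed

lemma payoff_paste:
  "payoff Y m (\<lambda>i \<omega>. if \<omega> \<in> A then \<tau> i \<omega> else \<tau>' i \<omega>) \<omega> =
    (if \<omega> \<in> A then payoff Y m \<tau> \<omega> else payoff Y m \<tau>' \<omega>)"
  by (simp add: payoff_def)

lemma integrable_payoff:
  "\<tau> \<in> multi_stopping_times M F X m C \<sigma> \<Longrightarrow> integrable M (payoff Y m \<tau>)"
  unfolding payoff_def[abs_def]
  by (intro Bochner_Integration.integrable_sum integrable_Y_at multi_stopping_time)

lemma payoff_nonneg: "\<omega> \<in> space M \<Longrightarrow> 0 \<le> payoff Y m \<tau> \<omega>"
  by (simp add: payoff_def sum_nonneg Y_nonneg)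

lemma payoff_le_dom: "AE \<omega> in M. payoff Y m \<tau> \<omega> \<le> real m * dom \<omega>"
  using Y_le_dom
proof eventually_elim
  case (elim \<omega>)
  then have "payoff Y m \<tau> \<omega> \<le> (\<Sum>i=1..m. dom \<omega>)"
    unfolding payoff_def by (intro sum_mono) auto
  then show ?case by simp
qed

section \<open>Conditional expectations at a stopping time\<close>

lemma cond_exp_at_eq: "cond_exp_at M F \<sigma> f = real_cond_exp M (pre_sigma \<sigma>) f"
  by (simp add: cond_exp_at_def)

lemma integrable_indicator_mult:
  "A \<in> sets M \<Longrightarrow> integrable M f \<Longrightarrow> integrable M (\<lambda>\<omega>. indicator A \<omega> * f \<omega> :: real)"
  using integrable_mult_indicator[of A M f] by simp

lemma expectation_cond_exp_at:
  assumes \<sigma>: "stopping_time F \<sigma>" and A: "A \<in> sets (pre_sigma \<sigma>)" and f: "integrable M f"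
  shows "expectation (\<lambda>\<omega>. indicator A \<omega> * cond_exp_at M F \<sigma> f \<omega>) = expectation (\<lambda>\<omega>. indicator A \<omega> * f \<omega>)"
proof -
  interpret G: finite_measure_subalgebra M "pre_sigma \<sigma>"
    by (rule finite_measure_subalgebra_pre_sigma[OF \<sigma>])
  show ?thesis
    unfolding cond_exp_at_eq
    using A f sets_pre_sigma_M[OF \<sigma> A]
    by (intro G.real_cond_exp_intg(2) integrable_indicator_mult) auto
qed

lemma integrable_cond_exp_at:
  "stopping_time F \<sigma> \<Longrightarrow> integrable M f \<Longrightarrow> integrable M (cond_exp_at M F \<sigma> f)"
  unfolding cond_exp_at_eq
  using finite_measure_subalgebra_pre_sigma finite_measure_subalgebra_is_sigma_finite
    sigma_finite_subalgebra.real_cond_exp_int(1) by blast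

lemma expectation_cond_exp_at_space:
  "stopping_time F \<sigma> \<Longrightarrow> integrable M f \<Longrightarrow> expectation (cond_exp_at M F \<sigma> f) = expectation f"
  unfolding cond_exp_at_eq
  using finite_measure_subalgebra_pre_sigma finite_measure_subalgebra_is_sigma_finite
    sigma_finite_subalgebra.real_cond_exp_int(2) by blast

lemma cond_exp_at_mono:
  assumes "stopping_time F \<sigma>" "integrable M f" "integrable M g" "AE \<omega> in M. f \<omega> \<le> g \<omega>"
  shows "AE \<omega> in M. cond_exp_at M F \<sigma> f \<omega> \<le> cond_exp_at M F \<sigma> g \<omega>"
proof -
  interpret G: finite_measure_subalgebra M "pre_sigma \<sigma>"
    by (rule finite_measure_subalgebra_pre_sigma[OF assms(1)])
  show ?thesis
    unfolding cond_exp_at_eq using assms by (intro G.real_cond_exp_mono)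
qed

lemma cond_exp_at_paste:
  assumes \<sigma>: "stopping_time F \<sigma>" and A: "A \<in> sets (pre_sigma \<sigma>)"
    and f: "integrable M f" and g: "integrable M g"
  shows "AE \<omega> in M. cond_exp_at M F \<sigma> (\<lambda>\<omega>. if \<omega> \<in> A then f \<omega> else g \<omega>) \<omega> =
    (if \<omega> \<in> A then cond_exp_at M F \<sigma> f \<omega> else cond_exp_at M F \<sigma> g \<omega>)"
proof -
  interpret G: finite_measure_subalgebra M "pre_sigma \<sigma>"
    by (rule finite_measure_subalgebra_pre_sigma[OF \<sigma>])
  have A': "- A \<inter> space M \<in> sets (pre_sigma \<sigma>)"
    using sets.compl_sets[OF A] by (simp add: space_pre_sigma Diff_eq Int_commute)
  have sM: "A \<in> sets M" "- A \<inter> space M \<in> sets M"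
    using A A' sets_pre_sigma_M[OF \<sigma>] by auto
  let ?A = "\<lambda>\<omega>. indicator A \<omega> :: real" and ?B = "\<lambda>\<omega>. indicator (- A \<inter> space M) \<omega> :: real"
  have [measurable]: "?A \<in> borel_measurable (pre_sigma \<sigma>)" "?B \<in> borel_measurable (pre_sigma \<sigma>)"
    using A A' by auto
  have i: "integrable M (\<lambda>\<omega>. ?A \<omega> * f \<omega>)" "integrable M (\<lambda>\<omega>. ?B \<omega> * g \<omega>)"
    using sM f g by (auto intro: integrable_indicator_mult)
  have "AE \<omega> in M. real_cond_exp M (pre_sigma \<sigma>) (\<lambda>\<omega>. if \<omega> \<in> A then f \<omega> else g \<omega>) \<omega> =
      real_cond_exp M (pre_sigma \<sigma>) (\<lambda>\<omega>. ?A \<omega> * f \<omega> + ?B \<omega> * g \<omega>) \<omega>"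
    using f g sM by (intro G.real_cond_exp_cong) (auto simp: indicator_def intro!: AE_I2)
  moreover have "AE \<omega> in M. real_cond_exp M (pre_sigma \<sigma>) (\<lambda>\<omega>. ?A \<omega> * f \<omega> + ?B \<omega> * g \<omega>) \<omega> =
      real_cond_exp M (pre_sigma \<sigma>) (\<lambda>\<omega>. ?A \<omega> * f \<omega>) \<omega> + real_cond_exp M (pre_sigma \<sigma>) (\<lambda>\<omega>. ?B \<omega> * g \<omega>) \<omega>"
    using i by (rule G.real_cond_exp_add)
  moreover have "AE \<omega> in M. real_cond_exp M (pre_sigma \<sigma>) (\<lambda>\<omega>. ?A \<omega> * f \<omega>) \<omega> =
      ?A \<omega> * real_cond_exp M (pre_sigma \<sigma>) f \<omega>"
    using f i by (intro G.real_cond_exp_mult) auto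
  moreover have "AE \<omega> in M. real_cond_exp M (pre_sigma \<sigma>) (\<lambda>\<omega>. ?B \<omega> * g \<omega>) \<omega> =
      ?B \<omega> * real_cond_exp M (pre_sigma \<sigma>) g \<omega>"
    using g i by (intro G.real_cond_exp_mult) auto
  ultimately show ?thesis
    unfolding cond_exp_at_eq using AE_space
    by eventually_elim (simp add: indicator_def)
qed

section \<open>The value of a tuple problem\<close>

text \<open>The conditional rewards are directed: of two tuples, follow on each
  \<open>\<omega>\<close> the one with the larger conditional reward. That choice is made on an
  event of the sigma-algebra at \<open>\<sigma>\<close>, so pasting is allowed. The integrable bound
  is the conditional expectation of \<open>m\<close> times \<open>dom\<close>.\<close>

lemma multi_value_ess_sup:
  assumes \<sigma>: "stopping_time F \<sigma>"
  shows "is_ess_sup M ((\<lambda>\<tau>. cond_exp_at M F \<sigma> (payoff Y m \<tau>)) ` multi_stopping_times M F X m C \<sigma>)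
      (multi_value M F X Y m C \<sigma>)" (is "?ess")
    and "integrable M (multi_value M F X Y m C \<sigma>)" (is "?int")
    and "e > 0 \<Longrightarrow> \<exists>\<tau>\<in>multi_stopping_times M F X m C \<sigma>.
      expectation (multi_value M F X Y m C \<sigma>) \<le> expectation (payoff Y m \<tau>) + e"
      (is "_ \<Longrightarrow> ?approx")
proof -
  interpret G: finite_measure_subalgebra M "pre_sigma \<sigma>"
    by (rule finite_measure_subalgebra_pre_sigma[OF \<sigma>])
  let ?T = "multi_stopping_times M F X m C \<sigma>"
  let ?H = "(\<lambda>\<tau>. cond_exp_at M F \<sigma> (payoff Y m \<tau>)) ` ?T"
  have "?ess \<and> ?int \<and> (e > 0 \<longrightarrow> ?approx)"
  proof (cases "m = 0")
    \<comment> \<open>Here the value is 0 by convention instead of being an \<open>ess_sup\<close>.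
      It is one nevertheless, as the zero payoff has conditional expectation 0; this gives the
      recursion its start.\<close>
    case True
    then have 0: "multi_value M F X Y m C \<sigma> = (\<lambda>_. 0)" "payoff Y m \<tau> = (\<lambda>_. 0)" for \<tau>
      by (auto simp: multi_value_def payoff_def)
    have "AE \<omega> in M. cond_exp_at M F \<sigma> (\<lambda>_. 0) \<omega> = 0"
      unfolding cond_exp_at_eq by (rule G.real_cond_exp_F_meas) auto
    moreover have "AE \<omega> in M. 0 \<le> Z' \<omega>"
      if "\<forall>h\<in>?H. AE \<omega> in M. h \<omega> \<le> Z' \<omega>" for Z'
    proof -
      have "AE \<omega> in M. cond_exp_at M F \<sigma> (\<lambda>_. 0) \<omega> \<le> Z' \<omega>"
        using that infinity_in_multi_stopping_times[of X m C \<sigma>] by (auto simp: 0)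
      with calculation show ?thesis
        by eventually_elim simp
    qed
    ultimately show ?thesis
      using infinity_in_multi_stopping_times[of X m C \<sigma>] by (auto simp: is_ess_sup_def 0)
  next
    case False
    then have Z: "multi_value M F X Y m C \<sigma> = ess_sup M ?H"
      by (simp add: multi_value_def payoff_def[abs_def])
    have ne: "?H \<noteq> {}"
      using infinity_in_multi_stopping_times[of X m C \<sigma>] by blast
    have int: "integrable M h" if "h \<in> ?H" for h
      using that \<sigma> by (auto intro: integrable_cond_exp_at integrable_payoff)
    have idom: "integrable M (\<lambda>\<omega>. real m * dom \<omega>)"
      using integrable_dom by simp
    have W: "AE \<omega> in M. h \<omega> \<le> cond_exp_at M F \<sigma> (\<lambda>\<omega>. real m * dom \<omega>) \<omega>" if "h \<in> ?H" for h
      using that \<sigma> idom payoff_le_dom by (auto intro!: cond_exp_at_mono integrable_payoff)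
    have dir: "\<exists>k\<in>?H. AE \<omega> in M. max (h \<omega>) (h' \<omega>) \<le> k \<omega>" if hH: "h \<in> ?H" "h' \<in> ?H" for h h'
    proof -
      obtain \<tau> \<tau>' where \<tau>: "\<tau> \<in> ?T" "\<tau>' \<in> ?T"
        and h: "h = cond_exp_at M F \<sigma> (payoff Y m \<tau>)" "h' = cond_exp_at M F \<sigma> (payoff Y m \<tau>')"
        using hH by auto
      define A where "A = {\<omega> \<in> space (pre_sigma \<sigma>). h' \<omega> \<le> h \<omega>}"
      have [measurable]: "h \<in> borel_measurable (pre_sigma \<sigma>)" "h' \<in> borel_measurable (pre_sigma \<sigma>)"
        by (simp_all add: h cond_exp_at_eq)
      have A: "A \<in> sets (pre_sigma \<sigma>)"
        unfolding A_def by measurable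
      define \<kappa> where "\<kappa> = (\<lambda>i \<omega>. if \<omega> \<in> A then \<tau> i \<omega> else \<tau>' i \<omega>)"
      have "\<kappa> \<in> multi_stopping_times M F X m C (\<lambda>\<omega>. if \<omega> \<in> A then \<sigma> \<omega> else \<sigma> \<omega>)"
        unfolding \<kappa>_def by (rule multi_stopping_times_paste[OF \<sigma> A \<tau>(1) _ \<tau>(2)]) auto
      then have \<kappa>: "\<kappa> \<in> ?T"
        by simp
      have P: "payoff Y m \<kappa> = (\<lambda>\<omega>. if \<omega> \<in> A then payoff Y m \<tau> \<omega> else payoff Y m \<tau>' \<omega>)"
        unfolding \<kappa>_def by (rule ext) (rule payoff_paste)
      have "AE \<omega> in M. cond_exp_at M F \<sigma> (payoff Y m \<kappa>) \<omega> = (if \<omega> \<in> A then h \<omega> else h' \<omega>)"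
        unfolding P h by (rule cond_exp_at_paste[OF \<sigma> A \<tau>[THEN integrable_payoff]])
      then have "AE \<omega> in M. max (h \<omega>) (h' \<omega>) \<le> cond_exp_at M F \<sigma> (payoff Y m \<kappa>) \<omega>"
        using AE_space by eventually_elim (auto simp: A_def space_pre_sigma)
      with \<kappa> show ?thesis
        by blast
    qed
    note esd = ess_sup_directed[OF ne int integrable_cond_exp_at[OF \<sigma> idom] W dir]
    have ?approx if "e > 0"
    proof -
      have "\<exists>h\<in>?H. expectation (ess_sup M ?H) \<le> expectation h + e"
        using \<open>e > 0\<close> by (intro esd(3))
      then obtain \<tau> where \<tau>: "\<tau> \<in> ?T"
        and "expectation (ess_sup M ?H) \<le> expectation (cond_exp_at M F \<sigma> (payoff Y m \<tau>)) + e"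
        by blast
      then have "expectation (ess_sup M ?H) \<le> expectation (payoff Y m \<tau>) + e"
        by (simp only: expectation_cond_exp_at_space[OF \<sigma> integrable_payoff[OF \<tau>]])
      with \<tau> show ?thesis
        unfolding Z by blast
    qed
    moreover have ?ess
      unfolding Z by (rule esd(1))
    moreover have ?int
      unfolding Z by (rule esd(2))
    ultimately show ?thesis
      by blast
  qed
  then show ?ess ?int "e > 0 \<Longrightarrow> ?approx"
    by auto
qed

lemma expectation_payoff_le_multi_value:
  assumes \<sigma>: "stopping_time F \<sigma>" and A: "A \<in> sets (pre_sigma \<sigma>)"
    and \<tau>: "\<tau> \<in> multi_stopping_times M F X m C \<sigma>"
  shows "expectation (\<lambda>\<omega>. indicator A \<omega> * payoff Y m \<tau> \<omega>) \<le>
    expectation (\<lambda>\<omega>. indicator A \<omega> * multi_value M F X Y m C \<sigma> \<omega>)"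
proof -
  have AM: "A \<in> sets M"
    using \<sigma> A by (rule sets_pre_sigma_M)
  have "AE \<omega> in M. cond_exp_at M F \<sigma> (payoff Y m \<tau>) \<omega> \<le> multi_value M F X Y m C \<sigma> \<omega>"
    using multi_value_ess_sup(1)[OF \<sigma>, of m X C] \<tau> by (auto simp: is_ess_sup_def)
  then have "expectation (\<lambda>\<omega>. indicator A \<omega> * cond_exp_at M F \<sigma> (payoff Y m \<tau>) \<omega>) \<le>
      expectation (\<lambda>\<omega>. indicator A \<omega> * multi_value M F X Y m C \<sigma> \<omega>)"
    using AM \<sigma> \<tau>
    by (intro integral_mono_AE integrable_indicator_mult integrable_cond_exp_at integrable_payoff
        multi_value_ess_sup(2)) (auto elim!: eventually_mono simp: indicator_def)
  then show ?thesis
    by (simp add: expectation_cond_exp_at[OF \<sigma> A integrable_payoff[OF \<tau>]])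
qed

lemma expectation_indicator_compl:
  fixes f :: "'a \<Rightarrow> real"
  assumes "A \<in> sets M" "integrable M f"
  shows "expectation f = expectation (\<lambda>\<omega>. indicator A \<omega> * f \<omega>) + expectation (\<lambda>\<omega>. indicator (space M - A) \<omega> * f \<omega>)"
proof -
  have "expectation f = expectation (\<lambda>\<omega>. indicator A \<omega> * f \<omega> + indicator (space M - A) \<omega> * f \<omega>)"
    by (intro Bochner_Integration.integral_cong) (auto simp: indicator_def)
  also have "\<dots> = expectation (\<lambda>\<omega>. indicator A \<omega> * f \<omega>) + expectation (\<lambda>\<omega>. indicator (space M - A) \<omega> * f \<omega>)"
    using assms by (intro Bochner_Integration.integral_add integrable_indicator_mult) auto
  finally show ?thesis .
qed

text \<open>A tuple within \<open>e\<close> of the optimum on the whole space is within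
  \<open>e\<close> on \<open>A\<close> too: on the complement it cannot exceed the value, so it
  cannot make up there for a larger deficit on \<open>A\<close>.\<close>

lemma multi_value_approx:
  assumes \<sigma>: "stopping_time F \<sigma>" and A: "A \<in> sets (pre_sigma \<sigma>)" and e: "e > 0"
  shows "\<exists>\<tau>\<in>multi_stopping_times M F X m C \<sigma>.
    expectation (\<lambda>\<omega>. indicator A \<omega> * multi_value M F X Y m C \<sigma> \<omega>) \<le>
    expectation (\<lambda>\<omega>. indicator A \<omega> * payoff Y m \<tau> \<omega>) + e"
proof -
  obtain \<tau> where \<tau>: "\<tau> \<in> multi_stopping_times M F X m C \<sigma>"
    and le: "expectation (multi_value M F X Y m C \<sigma>) \<le> expectation (payoff Y m \<tau>) + e"
    using multi_value_ess_sup(3)[OF \<sigma> e] by blast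
  have AM: "A \<in> sets M"
    using \<sigma> A by (rule sets_pre_sigma_M)
  have "space M - A \<in> sets (pre_sigma \<sigma>)"
    using sets.compl_sets[OF A] by (simp add: space_pre_sigma)
  then have "expectation (\<lambda>\<omega>. indicator (space M - A) \<omega> * payoff Y m \<tau> \<omega>) \<le>
      expectation (\<lambda>\<omega>. indicator (space M - A) \<omega> * multi_value M F X Y m C \<sigma> \<omega>)"
    using \<tau> by (rule expectation_payoff_le_multi_value[OF \<sigma>])
  with le show ?thesis
    unfolding expectation_indicator_compl[OF AM integrable_payoff[OF \<tau>]]
      expectation_indicator_compl[OF AM multi_value_ess_sup(2)[OF \<sigma>]]
    by (intro bexI[OF _ \<tau>]) simp
qed

lemma expectation_multi_value_leI:
  assumes \<sigma>: "stopping_time F \<sigma>" and A: "A \<in> sets (pre_sigma \<sigma>)"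
    and le: "\<And>\<tau>. \<tau> \<in> multi_stopping_times M F X m C \<sigma> \<Longrightarrow> expectation (\<lambda>\<omega>. indicator A \<omega> * payoff Y m \<tau> \<omega>) \<le> c"
  shows "expectation (\<lambda>\<omega>. indicator A \<omega> * multi_value M F X Y m C \<sigma> \<omega>) \<le> c"
proof (rule field_le_epsilon)
  fix e :: real assume "e > 0"
  then show "expectation (\<lambda>\<omega>. indicator A \<omega> * multi_value M F X Y m C \<sigma> \<omega>) \<le> c + e"
    using multi_value_approx[OF \<sigma> A \<open>e > 0\<close>, where m=m and X=X and C=C] le by force
qed

text \<open>A tuple for \<open>\<sigma>\<close>, kept on \<open>A\<close> and sent to infinity
  elsewhere, is admissible for \<open>\<sigma>'\<close> and earns the same on \<open>A\<close>. Used
  once this is monotonicity in the start; used in both directions, for starts that agree on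
  \<open>A\<close>, it is locality.\<close>

lemma expectation_multi_value_local_le:
  assumes \<sigma>: "stopping_time F \<sigma>" "A \<in> sets (pre_sigma \<sigma>)"
    and \<sigma>': "stopping_time F \<sigma>'" "A \<in> sets (pre_sigma \<sigma>')"
    and le: "\<And>\<omega>. \<omega> \<in> A \<Longrightarrow> \<sigma>' \<omega> \<le> \<sigma> \<omega>"
  shows "expectation (\<lambda>\<omega>. indicator A \<omega> * multi_value M F X Y m C \<sigma> \<omega>) \<le>
    expectation (\<lambda>\<omega>. indicator A \<omega> * multi_value M F X Y m C \<sigma>' \<omega>)"
proof (rule expectation_multi_value_leI[OF \<sigma>])
  fix \<tau> assume \<tau>: "\<tau> \<in> multi_stopping_times M F X m C \<sigma>"
  define \<kappa> where "\<kappa> = (\<lambda>i \<omega>. if \<omega> \<in> A then \<tau> i \<omega> else \<infinity>)"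
  have "\<kappa> \<in> multi_stopping_times M F X m C (\<lambda>\<omega>. if \<omega> \<in> A then \<sigma> \<omega> else \<infinity>)"
    unfolding \<kappa>_def
    by (rule multi_stopping_times_paste[OF \<sigma> \<tau> _ infinity_in_multi_stopping_times]) auto
  then have "\<kappa> \<in> multi_stopping_times M F X m C \<sigma>'"
    by (rule multi_stopping_times_antimono) (simp add: le)
  then have "expectation (\<lambda>\<omega>. indicator A \<omega> * payoff Y m \<kappa> \<omega>) \<le>
      expectation (\<lambda>\<omega>. indicator A \<omega> * multi_value M F X Y m C \<sigma>' \<omega>)"
    by (rule expectation_payoff_le_multi_value[OF \<sigma>'])
  moreover have "(\<lambda>\<omega>. indicator A \<omega> * payoff Y m \<kappa> \<omega>) = (\<lambda>\<omega>. indicator A \<omega> * payoff Y m \<tau> \<omega> :: real)"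
    unfolding \<kappa>_def by (auto simp: payoff_paste indicator_def)
  ultimately show "expectation (\<lambda>\<omega>. indicator A \<omega> * payoff Y m \<tau> \<omega>) \<le>
      expectation (\<lambda>\<omega>. indicator A \<omega> * multi_value M F X Y m C \<sigma>' \<omega>)"
    by simp
qed

end

section \<open>Limits and comparison of integrals\<close>

text \<open>Fatou's lemma for Bochner integrals; it also supplies the integrability of the
  limit.\<close>

lemma expectation_limit_le:
  fixes f :: "nat \<Rightarrow> 'a \<Rightarrow> real"
  assumes int: "\<And>k. integrable M (f k)" and nonneg: "\<And>k. AE \<omega> in M. 0 \<le> f k \<omega>"
    and g[measurable]: "g \<in> borel_measurable M" and lim: "AE \<omega> in M. (\<lambda>k. f k \<omega>) \<longlonglongrightarrow> g \<omega>"
    and L: "(\<lambda>k. integral\<^sup>L M (f k)) \<longlonglongrightarrow> L"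
  shows "integrable M g" and "integral\<^sup>L M g \<le> L" and "AE \<omega> in M. 0 \<le> g \<omega>"
proof -
  note [measurable] = borel_measurable_integrable[OF int]
  have nonneg': "AE \<omega> in M. \<forall>k. 0 \<le> f k \<omega>"
    using nonneg by (simp add: AE_all_countable)
  show g0: "AE \<omega> in M. 0 \<le> g \<omega>"
    using nonneg' lim by eventually_elim (auto intro: LIMSEQ_le_const)
  have L0: "0 \<le> L"
    using L by (rule LIMSEQ_le_const) (use nonneg in \<open>auto intro: integral_nonneg_AE\<close>)
  have "(\<integral>\<^sup>+\<omega>. ennreal (g \<omega>) \<partial>M) = (\<integral>\<^sup>+\<omega>. liminf (\<lambda>k. ennreal (f k \<omega>)) \<partial>M)"
  proof (rule nn_integral_cong_AE)
    show "AE \<omega> in M. ennreal (g \<omega>) = liminf (\<lambda>k. ennreal (f k \<omega>))"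
      using lim by eventually_elim (auto intro!: lim_imp_Liminf[symmetric] tendsto_ennrealI)
  qed
  also have "\<dots> \<le> liminf (\<lambda>k. \<integral>\<^sup>+\<omega>. ennreal (f k \<omega>) \<partial>M)"
    by (rule nn_integral_liminf) measurable
  also have "\<dots> = liminf (\<lambda>k. ennreal (integral\<^sup>L M (f k)))"
    using int nonneg by (simp add: nn_integral_eq_integral)
  also have "\<dots> = ennreal L"
    using L by (intro lim_imp_Liminf tendsto_ennrealI) auto
  finally have le: "(\<integral>\<^sup>+\<omega>. ennreal (g \<omega>) \<partial>M) \<le> ennreal L" .
  then show ig: "integrable M g"
    using g0 by (intro integrableI_nonneg) (auto intro: le_less_trans simp: ennreal_less_top)
  show "integral\<^sup>L M g \<le> L"
    using le L0 by (simp add: nn_integral_eq_integral[OF ig g0])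
qed

text \<open>A form of Vitali's theorem. Uniform integrability is expressed by
  \<open>f k \<le> c + h\<close>, with one constant \<open>c\<close> for all \<open>k\<close> and an
  \<open>h\<close> of small integral that may vary with \<open>k\<close>. Bounded convergence
  handles the truncation at \<open>c\<close>, and cutting off costs at most
  \<open>e\<close>.\<close>

lemma (in finite_measure) expectation_limit_eq:
  fixes f :: "nat \<Rightarrow> 'a \<Rightarrow> real"
  assumes int: "\<And>k. integrable M (f k)" and nonneg: "\<And>k. AE \<omega> in M. 0 \<le> f k \<omega>"
    and g: "g \<in> borel_measurable M" and lim: "AE \<omega> in M. (\<lambda>k. f k \<omega>) \<longlonglongrightarrow> g \<omega>"
    and L: "(\<lambda>k. integral\<^sup>L M (f k)) \<longlonglongrightarrow> L"
    and dom: "\<And>e. e > 0 \<Longrightarrow> \<exists>c. \<forall>k. \<exists>h. integrable M h \<and> (AE \<omega> in M. 0 \<le> h \<omega> \<and> f k \<omega> \<le> c + h \<omega>) \<and>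
      integral\<^sup>L M h \<le> e"
  shows "integrable M g" and "integral\<^sup>L M g = L"
proof -
  note fatou = expectation_limit_le[OF int nonneg g lim L]
  show "integrable M g"
    by (rule fatou(1))
  show "integral\<^sup>L M g = L"
  proof (rule antisym[OF fatou(2)], rule field_le_epsilon)
    fix e :: real assume "e > 0"
    obtain c where c: "\<And>k. \<exists>h. integrable M h \<and> (AE \<omega> in M. 0 \<le> h \<omega> \<and> f k \<omega> \<le> c + h \<omega>) \<and> integral\<^sup>L M h \<le> e"
      using dom[OF \<open>e > 0\<close>] by blast
    note [measurable] = borel_measurable_integrable[OF int] g
    have nonneg': "AE \<omega> in M. \<forall>k. 0 \<le> f k \<omega>"
      using nonneg by (simp add: AE_all_countable)
    have trunc_int: "integrable M (\<lambda>\<omega>. min (u \<omega>) c)" if "integrable M u" for u :: "'a \<Rightarrow> real"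
      using that by (intro Bochner_Integration.integrable_min) auto
    have trunc: "(\<lambda>k. \<integral>\<omega>. min (f k \<omega>) c \<partial>M) \<longlonglongrightarrow> (\<integral>\<omega>. min (g \<omega>) c \<partial>M)"
    proof (rule integral_dominated_convergence)
      show "integrable M (\<lambda>\<omega>. \<bar>c\<bar>)"
        by simp
      show "AE \<omega> in M. (\<lambda>k. min (f k \<omega>) c) \<longlonglongrightarrow> min (g \<omega>) c"
        using lim by eventually_elim (intro tendsto_intros)
      show "AE \<omega> in M. norm (min (f k \<omega>) c) \<le> \<bar>c\<bar>" for k
        using nonneg'
      proof eventually_elim
        case (elim \<omega>)
        then have "0 \<le> f k \<omega>" by simp
        then show ?case by (simp add: min_def)
      qed
    qed measurable
    have "integral\<^sup>L M (f k) \<le> (\<integral>\<omega>. min (f k \<omega>) c \<partial>M) + e" for k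
    proof -
      obtain h where h: "integrable M h" "AE \<omega> in M. 0 \<le> h \<omega> \<and> f k \<omega> \<le> c + h \<omega>" "integral\<^sup>L M h \<le> e"
        using c by blast
      have "integral\<^sup>L M (f k) \<le> (\<integral>\<omega>. min (f k \<omega>) c + h \<omega> \<partial>M)"
      proof (intro integral_mono_AE int Bochner_Integration.integrable_add trunc_int h(1))
        show "AE \<omega> in M. f k \<omega> \<le> min (f k \<omega>) c + h \<omega>"
          using h(2) by eventually_elim (auto simp: min_def)
      qed
      also have "\<dots> = (\<integral>\<omega>. min (f k \<omega>) c \<partial>M) + integral\<^sup>L M h"
        by (intro Bochner_Integration.integral_add trunc_int int h)
      finally show ?thesis
        using h(3) by simp
    qed
    then have "L \<le> (\<integral>\<omega>. min (g \<omega>) c \<partial>M) + e"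
      by (intro LIMSEQ_le[OF L tendsto_add[OF trunc tendsto_const]]) auto
    also have "(\<integral>\<omega>. min (g \<omega>) c \<partial>M) \<le> integral\<^sup>L M g"
      by (intro integral_mono_AE trunc_int fatou(1)) auto
    finally show "L \<le> integral\<^sup>L M g + e"
      by simp
  qed
qed

lemma AE_le_of_integrals:
  fixes f g :: "'a \<Rightarrow> real"
  assumes G: "subalgebra M G" and f: "integrable M f" "f \<in> borel_measurable G"
    and g: "integrable M g" "g \<in> borel_measurable G"
    and le: "\<And>A. A \<in> sets G \<Longrightarrow> (\<integral>\<omega>. indicator A \<omega> * f \<omega> \<partial>M) \<le> (\<integral>\<omega>. indicator A \<omega> * g \<omega> \<partial>M)"
  shows "AE \<omega> in M. f \<omega> \<le> g \<omega>"
proof -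
  note [measurable] = f(2) g(2)
  define A where "A = {\<omega> \<in> space G. g \<omega> < f \<omega>}"
  have A: "A \<in> sets G"
    unfolding A_def by measurable
  then have AM: "A \<in> sets M"
    using G by (auto simp: subalgebra_def)
  have i: "integrable M (\<lambda>\<omega>. indicator A \<omega> * f \<omega>)" "integrable M (\<lambda>\<omega>. indicator A \<omega> * g \<omega>)"
    using integrable_mult_indicator[OF AM f(1)] integrable_mult_indicator[OF AM g(1)] by auto
  have nonneg: "AE \<omega> in M. 0 \<le> indicator A \<omega> * f \<omega> - indicator A \<omega> * g \<omega>"
    by (rule AE_I2) (auto simp: A_def indicator_def)
  have "(\<integral>\<omega>. indicator A \<omega> * f \<omega> - indicator A \<omega> * g \<omega> \<partial>M) \<le> 0"
    using le[OF A] by (simp add: Bochner_Integration.integral_diff[OF i])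
  then have "(\<integral>\<omega>. indicator A \<omega> * f \<omega> - indicator A \<omega> * g \<omega> \<partial>M) = 0"
    using integral_nonneg_AE[OF nonneg] by simp
  then have "AE \<omega> in M. indicator A \<omega> * f \<omega> - indicator A \<omega> * g \<omega> = 0"
    using integral_nonneg_eq_0_iff_AE[OF Bochner_Integration.integrable_diff[OF i] nonneg] by simp
  then show ?thesis
    using AE_space
  proof eventually_elim
    case (elim \<omega>)
    then show ?case
      using G by (cases "g \<omega> < f \<omega>") (auto simp: A_def subalgebra_def)
  qed
qed

text \<open>As \<open>h\<close> lies below both \<open>f\<close> and \<open>V\<close>, the positive
  part of \<open>f - V\<close> is at most \<open>f - h\<close>, hence has integral at most
  \<open>e\<close>. In this way tuples that are nearly optimal only in the mean yield an almost sure
  inequality.\<close>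

lemma AE_le_of_approximation:
  fixes f V :: "'a \<Rightarrow> real"
  assumes f: "integrable M f" and V: "integrable M V"
    and approx: "\<And>e. e > 0 \<Longrightarrow> \<exists>h. integrable M h \<and> (AE \<omega> in M. h \<omega> \<le> f \<omega>) \<and> (AE \<omega> in M. h \<omega> \<le> V \<omega>) \<and>
      integral\<^sup>L M f \<le> integral\<^sup>L M h + e"
  shows "AE \<omega> in M. f \<omega> \<le> V \<omega>"
proof -
  have int: "integrable M (\<lambda>\<omega>. max 0 (f \<omega> - V \<omega>))"
    using f V by auto
  have "(\<integral>\<omega>. max 0 (f \<omega> - V \<omega>) \<partial>M) \<le> 0 + e" if "e > 0" for e
  proof -
    obtain h where h: "integrable M h" "AE \<omega> in M. h \<omega> \<le> f \<omega>" "AE \<omega> in M. h \<omega> \<le> V \<omega>"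
        "integral\<^sup>L M f \<le> integral\<^sup>L M h + e"
      using approx[OF \<open>e > 0\<close>] by blast
    have "AE \<omega> in M. max 0 (f \<omega> - V \<omega>) \<le> f \<omega> - h \<omega>"
      using h(2,3) by eventually_elim auto
    then have "(\<integral>\<omega>. max 0 (f \<omega> - V \<omega>) \<partial>M) \<le> (\<integral>\<omega>. f \<omega> - h \<omega> \<partial>M)"
      using int f h(1) by (intro integral_mono_AE) auto
    then show ?thesis
      using f h by simp
  qed
  then have "(\<integral>\<omega>. max 0 (f \<omega> - V \<omega>) \<partial>M) \<le> 0"
    by (rule field_le_epsilon)
  then have "(\<integral>\<omega>. max 0 (f \<omega> - V \<omega>) \<partial>M) = 0"
    by (intro antisym integral_nonneg_AE) auto
  then have "AE \<omega> in M. max 0 (f \<omega> - V \<omega>) = 0"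
    using int by (subst (asm) integral_nonneg_eq_0_iff_AE) auto
  then show ?thesis
    by eventually_elim (simp add: max_def split: if_splits)
qed

context reward_process
begin

section \<open>Right-continuity of the value\<close>

text \<open>A tuple starting at \<open>\<sigma>\<close> is moved to one starting at the later time \<open>s\<close> by delaying its entries
  as little as possible.\<close>

primrec delay ::
  "(ennreal \<Rightarrow> 'a \<Rightarrow> 'b) \<Rightarrow> (nat \<Rightarrow> 'b set) \<Rightarrow> (nat \<Rightarrow> 'a \<Rightarrow> ennreal) \<Rightarrow> ('a \<Rightarrow> ennreal) \<Rightarrow> nat \<Rightarrow> 'a \<Rightarrow> ennreal"
  where
    "delay X C \<tau> s 0 = s"
  | "delay X C \<tau> s (Suc i) =
      (\<lambda>\<omega>. max (\<tau> (Suc i) \<omega>) (if i = 0 then s \<omega> else entry_after X (C i) (delay X C \<tau> s i) \<omega>))"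

lemma delay_in_multi_stopping_times:
  assumes C: "\<And>i t. stopping_time F (entry_after X (C i) (\<lambda>_. t))"
    and \<tau>: "\<tau> \<in> multi_stopping_times M F X m C \<sigma>" and s: "stopping_time F s"
  shows "delay X C \<tau> s \<in> multi_stopping_times M F X m C s"
proof -
  have "stopping_time F (delay X C \<tau> s i)" if "i \<in> {1..m}" for i
    using that
  proof (induction i)
    case (Suc i)
    have "stopping_time F (\<tau> (Suc i))"
      using \<tau> Suc.prems by (rule multi_stopping_time)
    moreover have "stopping_time F (if i = 0 then s else entry_after X (C i) (delay X C \<tau> s i))"
    proof (cases "i = 0")
      case False
      then have "stopping_time F (entry_after X (C i) (delay X C \<tau> s i))"
        using Suc by (intro stopping_time_entry_after[OF C]) auto
      then show ?thesis
        using False by simp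
    qed (use s in simp)
    ultimately have "stopping_time F (\<lambda>\<omega>. max (\<tau> (Suc i) \<omega>) ((if i = 0 then s else entry_after X (C i) (delay X C \<tau> s i)) \<omega>))"
      by (rule stopping_time_max)
    also have "(\<lambda>\<omega>. max (\<tau> (Suc i) \<omega>) ((if i = 0 then s else entry_after X (C i) (delay X C \<tau> s i)) \<omega>)) = delay X C \<tau> s (Suc i)"
      by auto
    finally show ?case .
  qed simp
  then show ?thesis
    by (auto simp: multi_stopping_times_def)
qed

lemma delay_ge:
  assumes "i \<in> {1..m}"
  shows "\<tau> i \<omega> \<le> delay X C \<tau> s i \<omega>"
  using assms by (cases i) auto

text \<open>By induction along the tuple: the lower bound imposed on entry \<open>Suc i\<close>
  tends, by right-continuity of entry times, to the bound \<open>r\<close> which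
  \<open>\<tau> (Suc i)\<close> already satisfies. In the limit the maximum therefore changes
  nothing.\<close>

lemma delay_tendsto:
  assumes \<tau>: "\<tau> \<in> multi_stopping_times M F X m C \<sigma>" and \<omega>: "\<omega> \<in> space M"
    and s: "(\<lambda>k. s k \<omega>) \<longlonglongrightarrow> \<sigma> \<omega>" "\<And>k::nat. \<sigma> \<omega> \<le> s k \<omega>" and i: "i \<in> {1..m}"
  shows "(\<lambda>k. delay X C \<tau> (s k) i \<omega>) \<longlonglongrightarrow> \<tau> i \<omega>"
  using i
proof (induction i)
  case (Suc i)
  define r where "r = (if i = 0 then \<sigma> \<omega> else entry_after X (C i) (\<tau> i) \<omega>)"
  have "(\<lambda>k. if i = 0 then s k \<omega> else entry_after X (C i) (delay X C \<tau> (s k) i) \<omega>) \<longlonglongrightarrow> r"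
  proof (cases "i = 0")
    case False
    have "(\<lambda>k. entry_after X (C i) (\<lambda>_. delay X C \<tau> (s k) i \<omega>) \<omega>) \<longlonglongrightarrow> entry_after X (C i) (\<tau> i) \<omega>"
      using Suc False by (intro entry_after_tendsto delay_ge[where m=m]) auto
    moreover have "entry_after X (C i) (delay X C \<tau> (s k) i) \<omega> = entry_after X (C i) (\<lambda>_. delay X C \<tau> (s k) i \<omega>) \<omega>" for k
      by (rule entry_after_at)
    ultimately show ?thesis
      using False by (simp add: r_def)
  qed (use s in \<open>simp add: r_def\<close>)
  then have "(\<lambda>k. delay X C \<tau> (s k) (Suc i) \<omega>) \<longlonglongrightarrow> max (\<tau> (Suc i) \<omega>) r"
    unfolding delay.simps by (rule tendsto_max[OF tendsto_const])
  moreover have "r \<le> \<tau> (Suc i) \<omega>"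
    using \<tau> \<omega> Suc.prems by (auto simp: r_def multi_stopping_times_def)
  ultimately show ?case
    by (simp only: max_absorb1)
qed simp

text \<open>Starting later can only lose, which settles the upper half. The lower half needs the
  delayed tuples: their payoffs converge pointwise, because all entries converge from the right and
  \<open>Y\<close> is right-continuous, and they are dominated.\<close>

lemma expectation_multi_value_tendsto:
  assumes C: "\<And>i t. stopping_time F (entry_after X (C i) (\<lambda>_. t))"
    and \<sigma>: "stopping_time F \<sigma>" and s: "\<And>k::nat. stopping_time F (s k)"
    and ge: "\<And>k \<omega>. \<omega> \<in> space M \<Longrightarrow> \<sigma> \<omega> \<le> s k \<omega>"
    and lim: "\<And>\<omega>. \<omega> \<in> space M \<Longrightarrow> (\<lambda>k. s k \<omega>) \<longlonglongrightarrow> \<sigma> \<omega>"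
    and A: "A \<in> sets (pre_sigma \<sigma>)"
  shows "(\<lambda>k. expectation (\<lambda>\<omega>. indicator A \<omega> * multi_value M F X Y m C (s k) \<omega>))
    \<longlonglongrightarrow> expectation (\<lambda>\<omega>. indicator A \<omega> * multi_value M F X Y m C \<sigma> \<omega>)" (is "?v \<longlonglongrightarrow> ?V")
proof (rule order_tendstoI)
  have AM[measurable]: "A \<in> sets M"
    using \<sigma> A by (rule sets_pre_sigma_M)
  have A': "A \<in> sets (pre_sigma (s k))" for k
    using A mono_pre_sigma[OF \<sigma> s ge] by blast
  {
    fix a assume "?V < a"
    moreover have "?v k \<le> ?V" for k
      by (rule expectation_multi_value_local_le[OF s A' \<sigma> A]) (use ge sets.sets_into_space[OF AM] in auto)
    ultimately show "\<forall>\<^sub>F k in sequentially. ?v k < a"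
      by (intro always_eventually allI) (rule le_less_trans)
  }
  fix a assume a: "a < ?V"
  \<comment> \<open>An error of half the gap keeps the payoff strictly above
    \<open>a\<close>.\<close>
  obtain \<tau> where \<tau>: "\<tau> \<in> multi_stopping_times M F X m C \<sigma>"
    and "?V \<le> expectation (\<lambda>\<omega>. indicator A \<omega> * payoff Y m \<tau> \<omega>) + (?V - a) / 2"
    using multi_value_approx[OF \<sigma> A, of "(?V - a) / 2", where m=m and X=X and C=C] a by auto
  then have a': "a < expectation (\<lambda>\<omega>. indicator A \<omega> * payoff Y m \<tau> \<omega>)"
    using a by (simp add: field_simps)
  let ?d = "\<lambda>k. delay X C \<tau> (s k)"
  have d: "?d k \<in> multi_stopping_times M F X m C (s k)" for k
    by (rule delay_in_multi_stopping_times[OF C \<tau> s])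
  note [measurable] = borel_measurable_integrable[OF integrable_payoff[OF d]]
    borel_measurable_integrable[OF integrable_payoff[OF \<tau>]]
  have "(\<lambda>k. expectation (\<lambda>\<omega>. indicator A \<omega> * payoff Y m (?d k) \<omega>))
      \<longlonglongrightarrow> expectation (\<lambda>\<omega>. indicator A \<omega> * payoff Y m \<tau> \<omega>)"
  proof (rule integral_dominated_convergence)
    show "integrable M (\<lambda>\<omega>. real m * dom \<omega>)"
      using integrable_dom by simp
    show "AE \<omega> in M. (\<lambda>k. indicator A \<omega> * payoff Y m (?d k) \<omega>) \<longlonglongrightarrow> indicator A \<omega> * payoff Y m \<tau> \<omega>"
    proof (rule AE_I2)
      fix \<omega> assume \<omega>: "\<omega> \<in> space M"
      have "(\<lambda>k. Y (?d k i \<omega>) \<omega>) \<longlonglongrightarrow> Y (\<tau> i \<omega>) \<omega>" if "i \<in> {1..m}" for i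
        using delay_tendsto[where s=s, OF \<tau> \<omega> lim[OF \<omega>] ge[OF \<omega>] that] delay_ge[OF that]
        by (rule Y_at_tendsto[OF \<omega>])
      then show "(\<lambda>k. indicator A \<omega> * payoff Y m (?d k) \<omega>) \<longlonglongrightarrow> indicator A \<omega> * payoff Y m \<tau> \<omega>"
        unfolding payoff_def by (intro tendsto_mult[OF tendsto_const] tendsto_sum)
    qed
    show "AE \<omega> in M. norm (indicator A \<omega> * payoff Y m (?d k) \<omega>) \<le> real m * dom \<omega>" for k
      using payoff_le_dom[of m "?d k"] AE_space
    proof eventually_elim
      case (elim \<omega>)
      then show ?case
        using payoff_nonneg[OF elim(2), of m "?d k"] by (auto simp: indicator_def)
    qed
  qed measurable
  then have "\<forall>\<^sub>F k in sequentially. a < expectation (\<lambda>\<omega>. indicator A \<omega> * payoff Y m (?d k) \<omega>)"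
    using a' by (rule order_tendstoD)
  then show "\<forall>\<^sub>F k in sequentially. a < ?v k"
    by eventually_elim (erule less_le_trans[OF _ expectation_payoff_le_multi_value[OF s A' d]])
qed

lemma cond_exp_at_leI:
  assumes \<sigma>: "stopping_time F \<sigma>" and f: "integrable M f" and g: "integrable M g"
    and le: "\<And>A. A \<in> sets (pre_sigma \<sigma>) \<Longrightarrow>
      expectation (\<lambda>\<omega>. indicator A \<omega> * f \<omega>) \<le> expectation (\<lambda>\<omega>. indicator A \<omega> * g \<omega>)"
  shows "AE \<omega> in M. cond_exp_at M F \<sigma> f \<omega> \<le> cond_exp_at M F \<sigma> g \<omega>"
proof (rule AE_le_of_integrals[OF subalgebra_pre_sigma[OF \<sigma>]])
  show "cond_exp_at M F \<sigma> f \<in> borel_measurable (pre_sigma \<sigma>)" "cond_exp_at M F \<sigma> g \<in> borel_measurable (pre_sigma \<sigma>)"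
    by (simp_all add: cond_exp_at_eq)
qed (use assms in \<open>auto simp: integrable_cond_exp_at expectation_cond_exp_at\<close>)

section \<open>The value at an entry time as a process\<close>

lemma space_in_pre_sigma: "space M \<in> sets (pre_sigma \<sigma>)"
  using sets.top[of "pre_sigma \<sigma>"] by (simp add: space_pre_sigma)

lemma expectation_multi_value_nonneg:
  assumes \<sigma>: "stopping_time F \<sigma>" and A: "A \<in> sets (pre_sigma \<sigma>)"
  shows "0 \<le> expectation (\<lambda>\<omega>. indicator A \<omega> * multi_value M F X Y m C \<sigma> \<omega>)"
proof -
  have "0 \<le> expectation (\<lambda>\<omega>. indicator A \<omega> * payoff Y m (\<lambda>_ _. \<infinity>) \<omega>)"
    by (intro integral_nonneg_AE AE_I2) (auto simp: payoff_nonneg)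
  also have "\<dots> \<le> expectation (\<lambda>\<omega>. indicator A \<omega> * multi_value M F X Y m C \<sigma> \<omega>)"
    by (rule expectation_payoff_le_multi_value[OF \<sigma> A infinity_in_multi_stopping_times])
  finally show ?thesis .
qed

lemma expectation_multi_value_le_dom:
  assumes \<sigma>: "stopping_time F \<sigma>" and A: "A \<in> sets (pre_sigma \<sigma>)"
  shows "expectation (\<lambda>\<omega>. indicator A \<omega> * multi_value M F X Y m C \<sigma> \<omega>) \<le>
    expectation (\<lambda>\<omega>. indicator A \<omega> * (real m * dom \<omega>))"
proof (rule expectation_multi_value_leI[OF \<sigma> A])
  fix \<tau> assume \<tau>: "\<tau> \<in> multi_stopping_times M F X m C \<sigma>"
  show "expectation (\<lambda>\<omega>. indicator A \<omega> * payoff Y m \<tau> \<omega>) \<le> expectation (\<lambda>\<omega>. indicator A \<omega> * (real m * dom \<omega>))"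
  proof (rule integral_mono_AE)
    show "AE \<omega> in M. indicator A \<omega> * payoff Y m \<tau> \<omega> \<le> indicator A \<omega> * (real m * dom \<omega>)"
      using payoff_le_dom[of m \<tau>] by eventually_elim (auto simp: indicator_def)
  qed (use sets_pre_sigma_M[OF \<sigma> A] \<tau> integrable_dom in \<open>auto intro!: integrable_indicator_mult integrable_payoff\<close>)
qed

text \<open>Splits an integral over the finitely many values of the time. Applied with
  \<open>f\<close> constant in \<open>t\<close> and read backwards, it reassembles the
  pieces.\<close>

lemma expectation_process_at_disc:
  fixes f :: "ennreal \<Rightarrow> 'a \<Rightarrow> real"
  assumes \<tau>: "stopping_time F \<tau>" and f: "\<And>t. integrable M (f t)" and A: "A \<in> sets M"
  shows "integrable M (\<lambda>\<omega>. f (disc k (\<tau> \<omega>)) \<omega>)"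
    and "expectation (\<lambda>\<omega>. indicator A \<omega> * f (disc k (\<tau> \<omega>)) \<omega>) =
      (\<Sum>t\<in>grid k. expectation (\<lambda>\<omega>. indicator (A \<inter> {\<omega> \<in> space M. disc k (\<tau> \<omega>) = t}) \<omega> * f t \<omega>))"
proof -
  note [measurable] = measurable_disc[OF stopping_time_measurable[OF \<tau>], of k]
  have S: "A' \<inter> {\<omega> \<in> space M. disc k (\<tau> \<omega>) = t} \<in> sets M" if [measurable]: "A' \<in> sets M" for A' t
    by measurable
  have eq: "indicator A' \<omega> * f (disc k (\<tau> \<omega>)) \<omega> =
      (\<Sum>t\<in>grid k. indicator (A' \<inter> {\<omega> \<in> space M. disc k (\<tau> \<omega>) = t}) \<omega> * f t \<omega>)"
    if "\<omega> \<in> space M" for \<omega> A'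
  proof -
    have "(\<Sum>t\<in>grid k. indicator (A' \<inter> {\<omega> \<in> space M. disc k (\<tau> \<omega>) = t}) \<omega> * f t \<omega>) =
        (\<Sum>t\<in>grid k. if disc k (\<tau> \<omega>) = t then indicator A' \<omega> * f t \<omega> else 0)"
      using that by (intro sum.cong) (auto simp: indicator_def)
    then show ?thesis
      by simp
  qed
  have int: "integrable M (\<lambda>\<omega>. \<Sum>t\<in>grid k. indicator (A' \<inter> {\<omega> \<in> space M. disc k (\<tau> \<omega>) = t}) \<omega> * f t \<omega>)"
    if "A' \<in> sets M" for A'
    by (intro Bochner_Integration.integrable_sum integrable_indicator_mult S that f)
  have "integrable M (\<lambda>\<omega>. indicator (space M) \<omega> * f (disc k (\<tau> \<omega>)) \<omega>)"
    using int[OF sets.top] by (subst Bochner_Integration.integrable_cong[OF refl eq]) auto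
  then show "integrable M (\<lambda>\<omega>. f (disc k (\<tau> \<omega>)) \<omega>)"
    by (subst (asm) Bochner_Integration.integrable_cong[OF refl, where g="\<lambda>\<omega>. f (disc k (\<tau> \<omega>)) \<omega>"]) auto
  have "expectation (\<lambda>\<omega>. indicator A \<omega> * f (disc k (\<tau> \<omega>)) \<omega>) =
      expectation (\<lambda>\<omega>. \<Sum>t\<in>grid k. indicator (A \<inter> {\<omega> \<in> space M. disc k (\<tau> \<omega>) = t}) \<omega> * f t \<omega>)"
    by (rule Bochner_Integration.integral_cong[OF refl eq])
  also have "\<dots> = (\<Sum>t\<in>grid k. expectation (\<lambda>\<omega>. indicator (A \<inter> {\<omega> \<in> space M. disc k (\<tau> \<omega>) = t}) \<omega> * f t \<omega>))"
    by (intro Bochner_Integration.integral_sum integrable_indicator_mult S A f)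
  finally show "expectation (\<lambda>\<omega>. indicator A \<omega> * f (disc k (\<tau> \<omega>)) \<omega>) =
      (\<Sum>t\<in>grid k. expectation (\<lambda>\<omega>. indicator (A \<inter> {\<omega> \<in> space M. disc k (\<tau> \<omega>) = t}) \<omega> * f t \<omega>))" .
qed

lemma disc_event:
  assumes \<tau>: "stopping_time F \<tau>" and A: "A \<in> sets (pre_sigma \<tau>)"
  shows "A \<inter> {\<omega> \<in> space M. disc k (\<tau> \<omega>) = t} \<in> sets (pre_sigma (\<lambda>\<omega>. disc k (\<tau> \<omega>)))"
    and "A \<inter> {\<omega> \<in> space M. disc k (\<tau> \<omega>) = t} \<in> sets (F t)"
proof -
  note d = stopping_time_disc[OF \<tau>, of k]
  have A': "A \<in> sets (pre_sigma (\<lambda>\<omega>. disc k (\<tau> \<omega>)))"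
    using A mono_pre_sigma[OF \<tau> d] by auto
  have "{\<omega> \<in> space (pre_sigma (\<lambda>\<omega>. disc k (\<tau> \<omega>))). disc k (\<tau> \<omega>) = t} \<in> sets (pre_sigma (\<lambda>\<omega>. disc k (\<tau> \<omega>)))"
    using measurable_stopping_time_pre_sigma[OF d] by measurable
  then show *: "A \<inter> {\<omega> \<in> space M. disc k (\<tau> \<omega>) = t} \<in> sets (pre_sigma (\<lambda>\<omega>. disc k (\<tau> \<omega>)))"
    using A' by (auto simp: space_pre_sigma)
  have "{\<omega> \<in> A \<inter> {\<omega> \<in> space M. disc k (\<tau> \<omega>) = t}. disc k (\<tau> \<omega>) \<le> t} \<in> sets (F t)"
    by (rule sets_pre_sigmaD[OF d *])
  also have "{\<omega> \<in> A \<inter> {\<omega> \<in> space M. disc k (\<tau> \<omega>) = t}. disc k (\<tau> \<omega>) \<le> t} =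
      A \<inter> {\<omega> \<in> space M. disc k (\<tau> \<omega>) = t}"
    by auto
  finally show "A \<inter> {\<omega> \<in> space M. disc k (\<tau> \<omega>) = t} \<in> sets (F t)" .
qed

lemma expectation_modification:
  assumes f: "integrable M f" and R: "AE \<omega> in M. R \<omega> = real_cond_exp M (F t) f \<omega>"
    and [measurable]: "R \<in> borel_measurable M"
  shows "integrable M R"
    and "A \<in> sets (F t) \<Longrightarrow> expectation (\<lambda>\<omega>. indicator A \<omega> * R \<omega>) = expectation (\<lambda>\<omega>. indicator A \<omega> * f \<omega>)"
proof -
  interpret G: finite_measure_subalgebra M "F t"
    by (rule finite_measure_subalgebra_F)
  show "integrable M R"
    using integrable_cong_AE[OF _ _ R] G.real_cond_exp_int(1)[OF f] by simp
  assume A: "A \<in> sets (F t)"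
  then have AM[measurable]: "A \<in> sets M"
    using sets_F_subset by blast
  have "expectation (\<lambda>\<omega>. indicator A \<omega> * R \<omega>) = expectation (\<lambda>\<omega>. indicator A \<omega> * real_cond_exp M (F t) f \<omega>)"
  proof (rule integral_cong_AE)
    show "AE \<omega> in M. indicator A \<omega> * R \<omega> = indicator A \<omega> * real_cond_exp M (F t) f \<omega>"
      using R by eventually_elim simp
  qed measurable
  also have "\<dots> = expectation (\<lambda>\<omega>. indicator A \<omega> * f \<omega>)"
    using A AM f by (intro G.real_cond_exp_intg(2) integrable_indicator_mult) auto
  finally show "expectation (\<lambda>\<omega>. indicator A \<omega> * R \<omega>) = expectation (\<lambda>\<omega>. indicator A \<omega> * f \<omega>)" .
qed

lemma AE_le_modification:
  assumes f: "integrable M f" and g: "integrable M g"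
    and le: "\<And>A. A \<in> sets (F t) \<Longrightarrow> expectation (\<lambda>\<omega>. indicator A \<omega> * f \<omega>) \<le> expectation (\<lambda>\<omega>. indicator A \<omega> * g \<omega>)"
  shows "AE \<omega> in M. real_cond_exp M (F t) f \<omega> \<le> real_cond_exp M (F t) g \<omega>"
proof -
  interpret G: finite_measure_subalgebra M "F t"
    by (rule finite_measure_subalgebra_F)
  have "expectation (\<lambda>\<omega>. indicator A \<omega> * real_cond_exp M (F t) h \<omega>) = expectation (\<lambda>\<omega>. indicator A \<omega> * h \<omega>)"
    if "A \<in> sets (F t)" "integrable M h" for A h
    using that sets_F_subset by (intro G.real_cond_exp_intg(2) integrable_indicator_mult) auto
  then show ?thesis
    using f g le by (intro AE_le_of_integrals[OF G.subalg] G.real_cond_exp_int) auto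
qed

lemma expectation_excess_tendsto_0:
  "(\<lambda>d::nat. expectation (\<lambda>\<omega>. max 0 (real m * dom \<omega> - real d))) \<longlonglongrightarrow> 0"
proof -
  note [measurable] = borel_measurable_integrable[OF integrable_dom]
  have "(\<lambda>d::nat. expectation (\<lambda>\<omega>. max 0 (real m * dom \<omega> - real d))) \<longlonglongrightarrow> expectation (\<lambda>\<omega>. 0)"
  proof (rule integral_dominated_convergence)
    show "integrable M (\<lambda>\<omega>. real m * dom \<omega>)"
      using integrable_dom by simp
    show "AE \<omega> in M. (\<lambda>d. max 0 (real m * dom \<omega> - real d)) \<longlonglongrightarrow> 0"
    proof (rule AE_I2)
      fix \<omega>
      obtain N :: nat where "real m * dom \<omega> \<le> real N"
        using real_arch_simple by blast
      then have "\<forall>\<^sub>F d in sequentially. max 0 (real m * dom \<omega> - real d) = 0"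
        by (intro eventually_sequentiallyI[of N]) (simp add: max_def)
      then show "(\<lambda>d. max 0 (real m * dom \<omega> - real d)) \<longlonglongrightarrow> 0"
        by (rule tendsto_eventually)
    qed
    show "AE \<omega> in M. norm (max 0 (real m * dom \<omega> - real d)) \<le> real m * dom \<omega>" for d
    proof (rule AE_I2)
      fix \<omega>
      have "0 \<le> real m * dom \<omega>"
        by (simp add: dom_def)
      then show "norm (max 0 (real m * dom \<omega> - real d)) \<le> real m * dom \<omega>"
        by (simp add: max_def)
    qed
  qed measurable
  then show ?thesis
    by simp
qed

text \<open>For finitely valued \<open>\<tau>\<close> this is the definition of \<open>R\<close> together with the locality of the value;
  the general case is the limit along \<open>disc k \<circ> \<tau>\<close>, where \<open>R\<close> is uniformly integrable because it is
  dominated by the conditional expectations of \<open>m\<close> times the dominating variable.\<close>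

proposition expectation_modification_at:
  assumes C: "\<And>i t. stopping_time F (entry_after X (C i) (\<lambda>_. t))"
    and D: "\<And>t. stopping_time F (entry_after X D (\<lambda>_. t))"
    and R: "modification M (\<lambda>t. real_cond_exp M (F t) (multi_value M F X Y m C (entry_after X D (\<lambda>_. t)))) R"
    and R_rc: "right_continuous_process M R"
    and \<tau>: "stopping_time F \<tau>"
  shows "integrable M (\<lambda>\<omega>. R (\<tau> \<omega>) \<omega>)"
    and "A \<in> sets (pre_sigma \<tau>) \<Longrightarrow> expectation (\<lambda>\<omega>. indicator A \<omega> * R (\<tau> \<omega>) \<omega>) =
      expectation (\<lambda>\<omega>. indicator A \<omega> * multi_value M F X Y m C (entry_after X D \<tau>) \<omega>)"
proof -
  let ?V = "multi_value M F X Y m C"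
  have R_meas[measurable]: "R t \<in> borel_measurable M" for t
    using R by (simp add: modification_def)
  have R_eq: "AE \<omega> in M. R t \<omega> = real_cond_exp M (F t) (?V (entry_after X D (\<lambda>_. t))) \<omega>" for t
    using R by (simp add: modification_def)
  have V_int: "integrable M (?V \<sigma>)" if "stopping_time F \<sigma>" for \<sigma>
    using that by (rule multi_value_ess_sup(2))
  have R_int: "integrable M (R t)" for t
    using V_int[OF D] R_eq R_meas by (rule expectation_modification(1))
  have R_exp: "expectation (\<lambda>\<omega>. indicator A \<omega> * R t \<omega>) =
      expectation (\<lambda>\<omega>. indicator A \<omega> * ?V (entry_after X D (\<lambda>_. t)) \<omega>)" if "A \<in> sets (F t)" for A t
    using that by (rule expectation_modification(2)[OF V_int[OF D] R_eq R_meas])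
  have entry_event: "A \<in> sets (pre_sigma (entry_after X D (\<lambda>_. t)))" if "A \<in> sets (F t)" for A t
    by (rule sets_F_pre_sigma[OF D that entry_after_ge[of "\<lambda>_. t"]])
  have R_nonneg: "AE \<omega> in M. 0 \<le> R t \<omega>" for t
  proof -
    interpret G: finite_measure_subalgebra M "F t"
      by (rule finite_measure_subalgebra_F)
    have "AE \<omega> in M. real_cond_exp M (F t) (\<lambda>_. 0) \<omega> \<le> real_cond_exp M (F t) (?V (entry_after X D (\<lambda>_. t))) \<omega>"
      using expectation_multi_value_nonneg[OF D entry_event] by (intro AE_le_modification V_int D) auto
    moreover have "AE \<omega> in M. real_cond_exp M (F t) (\<lambda>_. 0) \<omega> = 0"
      by (rule G.real_cond_exp_F_meas) auto
    ultimately show ?thesis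
      using R_eq[of t] by eventually_elim simp
  qed
  \<comment> \<open>Splits \<open>m\<close> times \<open>dom\<close> into a part of size at most
    \<open>d\<close> and the excess over \<open>d\<close>, whose mean is small for large
    \<open>d\<close>. Conditioning preserves the split and gives the form \<open>c + h\<close>
    wanted by \<open>expectation_limit_eq\<close>.\<close>
  define U where "U = (\<lambda>(d::nat) \<omega>. max 0 (real m * dom \<omega> - real d))"
  have U_int: "integrable M (U d)" for d
    unfolding U_def using integrable_dom by auto
  have R_le: "AE \<omega> in M. 0 \<le> real_cond_exp M (F t) (U d) \<omega> \<and> R t \<omega> \<le> real d + real_cond_exp M (F t) (U d) \<omega>" for t d
  proof -
    interpret G: finite_measure_subalgebra M "F t"
      by (rule finite_measure_subalgebra_F)
    have "AE \<omega> in M. real_cond_exp M (F t) (?V (entry_after X D (\<lambda>_. t))) \<omega> \<le>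
        real_cond_exp M (F t) (\<lambda>\<omega>. real d + U d \<omega>) \<omega>"
    proof (rule AE_le_modification[OF V_int[OF D]])
      fix A assume A: "A \<in> sets (F t)"
      then have AM: "A \<in> sets M"
        using sets_F_subset by blast
      have "expectation (\<lambda>\<omega>. indicator A \<omega> * ?V (entry_after X D (\<lambda>_. t)) \<omega>) \<le>
          expectation (\<lambda>\<omega>. indicator A \<omega> * (real m * dom \<omega>))"
        by (rule expectation_multi_value_le_dom[OF D entry_event[OF A]])
      also have "\<dots> \<le> expectation (\<lambda>\<omega>. indicator A \<omega> * (real d + U d \<omega>))"
        using AM integrable_dom U_int
        by (intro integral_mono integrable_indicator_mult) (auto simp: U_def indicator_def)
      finally show "expectation (\<lambda>\<omega>. indicator A \<omega> * ?V (entry_after X D (\<lambda>_. t)) \<omega>) \<le>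
          expectation (\<lambda>\<omega>. indicator A \<omega> * (real d + U d \<omega>))" .
    qed (use U_int in auto)
    moreover have "AE \<omega> in M. real_cond_exp M (F t) (\<lambda>\<omega>. real d + U d \<omega>) \<omega> =
        real_cond_exp M (F t) (\<lambda>_. real d) \<omega> + real_cond_exp M (F t) (U d) \<omega>"
      using U_int by (intro G.real_cond_exp_add) auto
    moreover have "AE \<omega> in M. real_cond_exp M (F t) (\<lambda>_. real d) \<omega> = real d"
      by (rule G.real_cond_exp_F_meas) auto
    moreover have "AE \<omega> in M. 0 \<le> real_cond_exp M (F t) (U d) \<omega>"
      using U_int by (intro G.real_cond_exp_pos) (auto simp: U_def)
    ultimately show ?thesis
      using R_eq[of t] by eventually_elim simp
  qed
  let ?d = "\<lambda>k \<omega>. disc k (\<tau> \<omega>)"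
  note d = stopping_time_disc[OF \<tau>]
  have Rd_int: "integrable M (\<lambda>\<omega>. R (?d k \<omega>) \<omega>)" for k
    by (rule expectation_process_at_disc(1)[OF \<tau> R_int sets.top])
  have Rd_exp: "expectation (\<lambda>\<omega>. indicator A \<omega> * R (?d k \<omega>) \<omega>) =
      expectation (\<lambda>\<omega>. indicator A \<omega> * ?V (entry_after X D (?d k)) \<omega>)"
    if A: "A \<in> sets (pre_sigma \<tau>)" for A k
  proof -
    let ?A = "\<lambda>t. A \<inter> {\<omega> \<in> space M. ?d k \<omega> = t}"
    have AM: "A \<in> sets M"
      using \<tau> A by (rule sets_pre_sigma_M)
    note \<rho> = stopping_time_entry_after[OF D d, of k]
    have "expectation (\<lambda>\<omega>. indicator A \<omega> * R (?d k \<omega>) \<omega>) =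
        (\<Sum>t\<in>grid k. expectation (\<lambda>\<omega>. indicator (?A t) \<omega> * R t \<omega>))"
      by (rule expectation_process_at_disc(2)[OF \<tau> R_int AM])
    also have "\<dots> = (\<Sum>t\<in>grid k. expectation (\<lambda>\<omega>. indicator (?A t) \<omega> * ?V (entry_after X D (?d k)) \<omega>))"
    proof (rule sum.cong[OF refl])
      fix t
      note At = disc_event[OF \<tau> A, of k t]
      have 1: "?A t \<in> sets (pre_sigma (entry_after X D (?d k)))"
        using At(1) mono_pre_sigma[OF d \<rho> entry_after_ge] by blast
      have 2: "?A t \<in> sets (pre_sigma (entry_after X D (\<lambda>_. t)))"
        by (rule entry_event[OF At(2)])
      have eq: "entry_after X D (\<lambda>_. t) \<omega> = entry_after X D (?d k) \<omega>" if "\<omega> \<in> ?A t" for \<omega>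
        using that by (auto simp: entry_after_def)
      have "expectation (\<lambda>\<omega>. indicator (?A t) \<omega> * R t \<omega>) =
          expectation (\<lambda>\<omega>. indicator (?A t) \<omega> * ?V (entry_after X D (\<lambda>_. t)) \<omega>)"
        by (rule R_exp[OF At(2)])
      \<comment> \<open>Locality: the two starting times agree on \<open>?A t\<close>, an event
        known at either of them.\<close>
      also have "\<dots> = expectation (\<lambda>\<omega>. indicator (?A t) \<omega> * ?V (entry_after X D (?d k)) \<omega>)"
        using eq by (intro antisym expectation_multi_value_local_le D \<rho> 1 2) auto
      finally show "expectation (\<lambda>\<omega>. indicator (?A t) \<omega> * R t \<omega>) =
          expectation (\<lambda>\<omega>. indicator (?A t) \<omega> * ?V (entry_after X D (?d k)) \<omega>)" .
    qed
    also have "\<dots> = expectation (\<lambda>\<omega>. indicator A \<omega> * ?V (entry_after X D (?d k)) \<omega>)"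
      by (rule expectation_process_at_disc(2)[where f="\<lambda>_. ?V (entry_after X D (?d k))",
            OF \<tau> V_int[OF \<rho>] AM, symmetric])
    finally show ?thesis .
  qed
  have R_at[measurable]: "(\<lambda>\<omega>. R (\<tau> \<omega>) \<omega>) \<in> borel_measurable M"
    by (rule measurable_process_at[OF R_meas R_rc stopping_time_measurable[OF \<tau>]])
  have R_lim: "(\<lambda>k. R (?d k \<omega>) \<omega>) \<longlonglongrightarrow> R (\<tau> \<omega>) \<omega>" if "\<omega> \<in> space M" for \<omega>
  proof (rule right_limit_sequentially[where f="\<lambda>t. R t \<omega>"])
    show "\<tau> \<omega> < \<top> \<Longrightarrow> ((\<lambda>t. R t \<omega>) \<longlongrightarrow> R (\<tau> \<omega>) \<omega>) (at_right (\<tau> \<omega>))"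
      using R_rc that by (auto simp: right_continuous_process_def)
  qed (auto intro: disc_tendsto)
  have main: "integrable M (\<lambda>\<omega>. indicator A \<omega> * R (\<tau> \<omega>) \<omega>) \<and>
      expectation (\<lambda>\<omega>. indicator A \<omega> * R (\<tau> \<omega>) \<omega>) =
      expectation (\<lambda>\<omega>. indicator A \<omega> * ?V (entry_after X D \<tau>) \<omega>)"
    if A: "A \<in> sets (pre_sigma \<tau>)" for A
  proof -
    have AM[measurable]: "A \<in> sets M"
      using \<tau> A by (rule sets_pre_sigma_M)
    let ?f = "\<lambda>k \<omega>. indicator A \<omega> * R (?d k \<omega>) \<omega>"
    have f_int: "integrable M (?f k)" for k
      by (rule integrable_indicator_mult[OF AM Rd_int])
    have f_nonneg: "AE \<omega> in M. 0 \<le> ?f k \<omega>" for k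
    proof -
      \<comment> \<open>The exceptional null set depends on \<open>t\<close>; as the grid is finite,
        the union over its points is still null.\<close>
      have "AE \<omega> in M. \<forall>t\<in>grid k. 0 \<le> R t \<omega>"
        by (intro AE_finite_allI finite_grid R_nonneg)
      then show ?thesis
        by eventually_elim simp
    qed
    have f_lim: "AE \<omega> in M. (\<lambda>k. ?f k \<omega>) \<longlonglongrightarrow> indicator A \<omega> * R (\<tau> \<omega>) \<omega>"
      by (intro AE_I2 tendsto_mult[OF tendsto_const] R_lim)
    have L: "(\<lambda>k. expectation (?f k)) \<longlonglongrightarrow> expectation (\<lambda>\<omega>. indicator A \<omega> * ?V (entry_after X D \<tau>) \<omega>)"
      unfolding Rd_exp[OF A]
    \<comment> \<open>Entry times after \<open>?d k\<close> tend from the right to the entry time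
      after \<open>\<tau>\<close>, so right-continuity of the value is used at that entry
      time.\<close>
    proof (rule expectation_multi_value_tendsto[OF C])
      show "stopping_time F (entry_after X D \<tau>)" "stopping_time F (entry_after X D (?d k))" for k
        by (rule stopping_time_entry_after[OF D \<tau>], rule stopping_time_entry_after[OF D d])
      show "entry_after X D \<tau> \<omega> \<le> entry_after X D (?d k) \<omega>" for k \<omega>
        by (rule entry_after_mono) simp
      show "(\<lambda>k. entry_after X D (?d k) \<omega>) \<longlonglongrightarrow> entry_after X D \<tau> \<omega>" for \<omega>
        using entry_after_tendsto[of "\<lambda>k. ?d k \<omega>" \<tau> \<omega> X D, OF disc_tendsto disc_ge]
        by (simp only: entry_after_at[of X D "?d _" \<omega>])
      show "A \<in> sets (pre_sigma (entry_after X D \<tau>))"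
        using A mono_pre_sigma[OF \<tau> stopping_time_entry_after[OF D \<tau>] entry_after_ge] by blast
    qed
    have f_dom: "\<exists>c. \<forall>k. \<exists>h. integrable M h \<and> (AE \<omega> in M. 0 \<le> h \<omega> \<and> ?f k \<omega> \<le> c + h \<omega>) \<and> expectation h \<le> e"
      if "e > 0" for e
    proof -
      have "\<forall>\<^sub>F n in sequentially. expectation (U n) < e"
        unfolding U_def using expectation_excess_tendsto_0 that by (rule order_tendstoD)
      then obtain n where n: "expectation (U n) < e"
        by (auto simp: eventually_sequentially)
      \<comment> \<open>The conditioning sigma-algebra varies with \<open>\<omega>\<close>, but on a
        grid only finitely many versions of the conditional expectation are involved.\<close>
      let ?h = "\<lambda>k \<omega>. real_cond_exp M (F (?d k \<omega>)) (U n) \<omega>"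
      have ce_int: "integrable M (real_cond_exp M (F t) (U n))"
        and ce_exp: "A \<in> sets (F t) \<Longrightarrow> expectation (\<lambda>\<omega>. indicator A \<omega> * real_cond_exp M (F t) (U n) \<omega>) =
          expectation (\<lambda>\<omega>. indicator A \<omega> * U n \<omega>)" for t A
        using expectation_modification[OF U_int, of "real_cond_exp M (F t) (U n)" t n] by auto
      have "integrable M (?h k)" for k
        by (rule expectation_process_at_disc(1)[OF \<tau> ce_int sets.top])
      moreover have "AE \<omega> in M. 0 \<le> ?h k \<omega> \<and> ?f k \<omega> \<le> real n + ?h k \<omega>" for k
      proof -
        have "AE \<omega> in M. \<forall>t\<in>grid k. 0 \<le> real_cond_exp M (F t) (U n) \<omega> \<and>
            R t \<omega> \<le> real n + real_cond_exp M (F t) (U n) \<omega>"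
          by (intro AE_finite_allI finite_grid R_le)
        then show ?thesis
        proof eventually_elim
          case (elim \<omega>)
          then have "0 \<le> ?h k \<omega>" "R (?d k \<omega>) \<omega> \<le> real n + ?h k \<omega>"
            using disc_in_grid by blast+
          then show ?case
            by (auto simp: indicator_def)
        qed
      qed
      moreover have "expectation (?h k) \<le> e" for k
      proof -
        \<comment> \<open>The mean of \<open>?h k\<close> is that of \<open>U n\<close> for every
          \<open>k\<close>: on each piece \<open>?S t\<close>, an event of \<open>F t\<close>, the
          conditioning can be undone.\<close>
        let ?S = "\<lambda>t. space M \<inter> {\<omega> \<in> space M. ?d k \<omega> = t}"
        have "expectation (\<lambda>\<omega>. indicator (space M) \<omega> * ?h k \<omega>) =
            (\<Sum>t\<in>grid k. expectation (\<lambda>\<omega>. indicator (?S t) \<omega> * real_cond_exp M (F t) (U n) \<omega>))"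
          by (rule expectation_process_at_disc(2)[OF \<tau> ce_int sets.top])
        also have "\<dots> = (\<Sum>t\<in>grid k. expectation (\<lambda>\<omega>. indicator (?S t) \<omega> * U n \<omega>))"
          by (intro sum.cong refl ce_exp disc_event(2)[OF \<tau> space_in_pre_sigma])
        also have "\<dots> = expectation (\<lambda>\<omega>. indicator (space M) \<omega> * U n \<omega>)"
          by (rule expectation_process_at_disc(2)[where f="\<lambda>_. U n", OF \<tau> U_int sets.top, symmetric])
        finally have "expectation (?h k) = expectation (U n)"
          by (simp cong: Bochner_Integration.integral_cong)
        then show ?thesis
          using n by simp
      qed
      ultimately show ?thesis
        by blast
    qed
    show ?thesis
      using expectation_limit_eq[OF f_int f_nonneg _ f_lim L f_dom] by simp
  qed
  show "integrable M (\<lambda>\<omega>. R (\<tau> \<omega>) \<omega>)"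
    using main[OF space_in_pre_sigma] by (simp cong: Bochner_Integration.integrable_cong)
  show "A \<in> sets (pre_sigma \<tau>) \<Longrightarrow> expectation (\<lambda>\<omega>. indicator A \<omega> * R (\<tau> \<omega>) \<omega>) =
      expectation (\<lambda>\<omega>. indicator A \<omega> * ?V (entry_after X D \<tau>) \<omega>)"
    using main by blast
qed

section \<open>Reduction to a single stopping time\<close>

lemma payoff_Suc: "payoff Y (Suc m) \<tau> \<omega> = Y (\<tau> 1 \<omega>) \<omega> + payoff Y m (\<lambda>i. \<tau> (Suc i)) \<omega>"
  unfolding payoff_def by (simp add: sum.atLeast_Suc_atMost sum.shift_bounds_cl_Suc_ivl del: sum.cl_ivl_Suc)

text \<open>For \<open>m = 0\<close> the family still puts a lower bound on entry 1, and nothing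
  guarantees it for the tail.\<close>

lemma multi_stopping_times_tail:
  assumes \<tau>: "\<tau> \<in> multi_stopping_times M F X (Suc m) B \<sigma>" and m: "m \<noteq> 0"
  shows "(\<lambda>i. \<tau> (Suc i)) \<in> multi_stopping_times M F X m (\<lambda>i. B (Suc i)) (entry_after X (B 1) (\<tau> 1))"
proof -
  have "entry_after X (B i) (\<tau> i) \<omega> \<le> \<tau> (Suc i) \<omega>" if "i \<in> {1..<Suc m}" "\<omega> \<in> space M" for i \<omega>
    using \<tau> that unfolding multi_stopping_times_def by blast
  from this[of 1] this[of "Suc _"] show ?thesis
    using \<tau> m by (auto simp: multi_stopping_times_def)
qed

text \<open>Tuples are numbered from 1, so the outer \<open>case_nat\<close> fills index 0; entry 1
  is \<open>\<tau>\<close> and entry \<open>Suc (Suc i)\<close> is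
  \<open>\<kappa> (Suc i)\<close>.\<close>

lemma multi_stopping_times_Cons:
  assumes \<tau>: "stopping_time F \<tau>" "\<And>\<omega>. \<omega> \<in> space M \<Longrightarrow> \<sigma> \<omega> \<le> \<tau> \<omega>"
    and \<kappa>: "\<kappa> \<in> multi_stopping_times M F X m (\<lambda>i. B (Suc i)) (entry_after X (B 1) \<tau>)"
  shows "case_nat undefined (case_nat \<tau> (\<lambda>i. \<kappa> (Suc i))) \<in> multi_stopping_times M F X (Suc m) B \<sigma>"
  unfolding multi_stopping_times_def
proof (intro CollectI conjI ballI)
  fix i assume "i \<in> {1..Suc m}"
  then show "stopping_time F (case_nat undefined (case_nat \<tau> (\<lambda>i. \<kappa> (Suc i))) i)"
    using \<tau>(1) multi_stopping_time[OF \<kappa>] by (auto split: nat.split)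
next
  fix \<omega> assume "\<omega> \<in> space M"
  then show "\<sigma> \<omega> \<le> case_nat undefined (case_nat \<tau> (\<lambda>i. \<kappa> (Suc i))) 1 \<omega>"
    using \<tau>(2) by simp
next
  fix i \<omega> assume i: "i \<in> {1..<Suc m}" and \<omega>: "\<omega> \<in> space M"
  then obtain j where j: "i = Suc j" "j < m"
    by (cases i) auto
  have "entry_after X (B 1) \<tau> \<omega> \<le> \<kappa> 1 \<omega>"
    using \<kappa> \<omega> by (simp add: multi_stopping_times_def)
  moreover have "entry_after X (B (Suc j)) (\<kappa> j) \<omega> \<le> \<kappa> (Suc j) \<omega>" if "j \<in> {1..<m}"
    using \<kappa> \<omega> that by (simp add: multi_stopping_times_def)
  ultimately show "entry_after X (B i) (case_nat undefined (case_nat \<tau> (\<lambda>i. \<kappa> (Suc i))) i) \<omega> \<le>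
      case_nat undefined (case_nat \<tau> (\<lambda>i. \<kappa> (Suc i))) (Suc i) \<omega>"
    using j by (auto split: nat.split)
qed

text \<open>The families of conditional rewards are compared in both directions. A tuple is beaten
  by its first entry, because \<open>R\<close> already accounts for the best continuation.
  Conversely a single time is matched only up to \<open>e\<close> in the mean, as a best
  continuation need not exist.\<close>

proposition multi_value_Suc:
  assumes B: "\<And>i t. stopping_time F (entry_after X (B i) (\<lambda>_. t))"
    and R: "modification M (multi_value_next M F X Y m B) R"
    and R_rc: "right_continuous_process M R"
    and \<sigma>: "stopping_time F \<sigma>"
  shows "is_ess_sup M ((\<lambda>\<tau>. cond_exp_at M F \<sigma> (\<lambda>\<omega>. Y (\<tau> \<omega>) \<omega> + R (\<tau> \<omega>) \<omega>)) ` stopping_times_from M F \<sigma>)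
    (multi_value M F X Y (Suc m) B \<sigma>)"
proof -
  let ?C = "\<lambda>i. B (Suc i)" and ?V = "multi_value M F X Y (Suc m) B \<sigma>"
  let ?W = "\<lambda>\<tau>. multi_value M F X Y m ?C (entry_after X (B 1) \<tau>)"
  let ?g = "\<lambda>\<tau> \<omega>. Y (\<tau> \<omega>) \<omega> + R (\<tau> \<omega>) \<omega>"
  have R': "modification M (\<lambda>t. real_cond_exp M (F t) (multi_value M F X Y m ?C (entry_after X (B 1) (\<lambda>_. t)))) R"
    using R by (simp add: modification_def multi_value_next_def)
  note R_int = expectation_modification_at(1)[where C="?C", OF B B R' R_rc]
  note R_exp = expectation_modification_at(2)[where C="?C", OF B B R' R_rc]
  have g_int: "integrable M (?g \<tau>)" if "stopping_time F \<tau>" for \<tau>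
    by (intro Bochner_Integration.integrable_add integrable_Y_at R_int that)
  have V_ess: "is_ess_sup M ((\<lambda>\<tau>. cond_exp_at M F \<sigma> (payoff Y (Suc m) \<tau>)) ` multi_stopping_times M F X (Suc m) B \<sigma>) ?V"
    by (rule multi_value_ess_sup(1)[OF \<sigma>])
  have upper: "AE \<omega> in M. cond_exp_at M F \<sigma> (payoff Y (Suc m) \<tau>) \<omega> \<le> cond_exp_at M F \<sigma> (?g (\<tau> 1)) \<omega>"
    if \<tau>: "\<tau> \<in> multi_stopping_times M F X (Suc m) B \<sigma>" for \<tau>
  proof (rule cond_exp_at_leI[OF \<sigma> integrable_payoff[OF \<tau>] g_int])
    show \<tau>1: "stopping_time F (\<tau> 1)"
      using \<tau> by (rule multi_stopping_time) simp
    fix A assume A: "A \<in> sets (pre_sigma \<sigma>)"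
    have "\<sigma> \<omega> \<le> \<tau> 1 \<omega>" if "\<omega> \<in> space M" for \<omega>
      using \<tau> that by (rule multi_stopping_times_ge) simp
    then have A1: "A \<in> sets (pre_sigma (\<tau> 1))"
      using A mono_pre_sigma[OF \<sigma> \<tau>1] by blast
    note \<rho> = stopping_time_entry_after[OF B \<tau>1]
    have A2: "A \<in> sets (pre_sigma (entry_after X (B 1) (\<tau> 1)))"
      using A1 mono_pre_sigma[OF \<tau>1 \<rho> entry_after_ge] by blast
    have AM: "A \<in> sets M"
      using \<sigma> A by (rule sets_pre_sigma_M)
    let ?t = "\<lambda>i. \<tau> (Suc i)"
    have "expectation (\<lambda>\<omega>. indicator A \<omega> * payoff Y m ?t \<omega>) \<le> expectation (\<lambda>\<omega>. indicator A \<omega> * ?W (\<tau> 1) \<omega>)"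
    \<comment> \<open>An empty tail is not covered by \<open>multi_stopping_times_tail\<close>;
      payoff and value are then both 0.\<close>
    proof (cases "m = 0")
      case True
      then show ?thesis
        by (simp add: payoff_def multi_value_def)
    next
      case False
      then show ?thesis
        using \<tau> by (intro expectation_payoff_le_multi_value \<rho> A2 multi_stopping_times_tail)
    qed
    also have "\<dots> = expectation (\<lambda>\<omega>. indicator A \<omega> * R (\<tau> 1 \<omega>) \<omega>)"
      by (rule R_exp[OF \<tau>1 A1, symmetric])
    finally have le: "expectation (\<lambda>\<omega>. indicator A \<omega> * payoff Y m ?t \<omega>) \<le>
      expectation (\<lambda>\<omega>. indicator A \<omega> * R (\<tau> 1 \<omega>) \<omega>)" .
    have t_int: "integrable M (payoff Y m ?t)"
      unfolding payoff_def[abs_def]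
      by (intro Bochner_Integration.integrable_sum integrable_Y_at multi_stopping_time[OF \<tau>]) auto
    have "expectation (\<lambda>\<omega>. indicator A \<omega> * payoff Y (Suc m) \<tau> \<omega>) =
        expectation (\<lambda>\<omega>. indicator A \<omega> * Y (\<tau> 1 \<omega>) \<omega>) + expectation (\<lambda>\<omega>. indicator A \<omega> * payoff Y m ?t \<omega>)"
      unfolding payoff_Suc distrib_left
      by (intro Bochner_Integration.integral_add integrable_indicator_mult AM integrable_Y_at \<tau>1 t_int)
    also have "\<dots> \<le> expectation (\<lambda>\<omega>. indicator A \<omega> * Y (\<tau> 1 \<omega>) \<omega>) + expectation (\<lambda>\<omega>. indicator A \<omega> * R (\<tau> 1 \<omega>) \<omega>)"
      using le by simp
    also have "\<dots> = expectation (\<lambda>\<omega>. indicator A \<omega> * ?g (\<tau> 1) \<omega>)"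
      unfolding distrib_left
      by (intro Bochner_Integration.integral_add[symmetric] integrable_indicator_mult AM integrable_Y_at \<tau>1 R_int)
    finally show "expectation (\<lambda>\<omega>. indicator A \<omega> * payoff Y (Suc m) \<tau> \<omega>) \<le>
      expectation (\<lambda>\<omega>. indicator A \<omega> * ?g (\<tau> 1) \<omega>)" .
  qed
  \<comment> \<open>Extending \<open>\<tau>\<close> by a nearly optimal continuation gives a tuple
    whose conditional reward lies below both sides and falls short of the left one by at most
    \<open>e\<close> in the mean.\<close>
  have lower: "AE \<omega> in M. cond_exp_at M F \<sigma> (?g \<tau>) \<omega> \<le> ?V \<omega>" if "\<tau> \<in> stopping_times_from M F \<sigma>" for \<tau>
  proof (rule AE_le_of_approximation)
    have \<tau>: "stopping_time F \<tau>" and \<sigma>\<tau>: "\<And>\<omega>. \<omega> \<in> space M \<Longrightarrow> \<sigma> \<omega> \<le> \<tau> \<omega>"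
      using that by (auto simp: stopping_times_from_def)
    show "integrable M (cond_exp_at M F \<sigma> (?g \<tau>))"
      by (rule integrable_cond_exp_at[OF \<sigma> g_int[OF \<tau>]])
    show "integrable M ?V"
      by (rule multi_value_ess_sup(2)[OF \<sigma>])
    fix e :: real assume "e > 0"
    note \<rho> = stopping_time_entry_after[OF B \<tau>]
    obtain \<kappa> where \<kappa>: "\<kappa> \<in> multi_stopping_times M F X m ?C (entry_after X (B 1) \<tau>)"
      and W_le: "expectation (?W \<tau>) \<le> expectation (payoff Y m \<kappa>) + e"
      using multi_value_ess_sup(3)[OF \<rho> \<open>e > 0\<close>] by blast
    define \<eta> where "\<eta> = case_nat undefined (case_nat \<tau> (\<lambda>i. \<kappa> (Suc i)))"
    have \<eta>: "\<eta> \<in> multi_stopping_times M F X (Suc m) B \<sigma>"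
      unfolding \<eta>_def by (rule multi_stopping_times_Cons[OF \<tau> \<sigma>\<tau> \<kappa>])
    have \<eta>1: "\<eta> 1 = \<tau>"
      by (simp add: \<eta>_def)
    have P: "payoff Y (Suc m) \<eta> = (\<lambda>\<omega>. Y (\<tau> \<omega>) \<omega> + payoff Y m \<kappa> \<omega>)"
      unfolding payoff_Suc \<eta>1 by (auto simp: payoff_def \<eta>_def intro!: ext sum.cong split: nat.split)
    have R_W: "expectation (\<lambda>\<omega>. R (\<tau> \<omega>) \<omega>) = expectation (?W \<tau>)"
      using R_exp[OF \<tau> space_in_pre_sigma] by (simp cong: Bochner_Integration.integral_cong)
    have "expectation (cond_exp_at M F \<sigma> (?g \<tau>)) = expectation (?g \<tau>)"
      by (rule expectation_cond_exp_at_space[OF \<sigma> g_int[OF \<tau>]])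
    also have "\<dots> = expectation (\<lambda>\<omega>. Y (\<tau> \<omega>) \<omega>) + expectation (?W \<tau>)"
      unfolding R_W[symmetric] by (intro Bochner_Integration.integral_add integrable_Y_at R_int \<tau>)
    also have "\<dots> \<le> expectation (\<lambda>\<omega>. Y (\<tau> \<omega>) \<omega>) + expectation (payoff Y m \<kappa>) + e"
      using W_le by simp
    also have "\<dots> = expectation (payoff Y (Suc m) \<eta>) + e"
      unfolding P using integrable_Y_at[OF \<tau>] integrable_payoff[OF \<kappa>] by simp
    also have "\<dots> = expectation (cond_exp_at M F \<sigma> (payoff Y (Suc m) \<eta>)) + e"
      by (simp add: expectation_cond_exp_at_space[OF \<sigma> integrable_payoff[OF \<eta>]])
    finally have "expectation (cond_exp_at M F \<sigma> (?g \<tau>)) \<le> expectation (cond_exp_at M F \<sigma> (payoff Y (Suc m) \<eta>)) + e" .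
    moreover have "AE \<omega> in M. cond_exp_at M F \<sigma> (payoff Y (Suc m) \<eta>) \<omega> \<le> ?V \<omega>"
      using V_ess \<eta> by (auto simp: is_ess_sup_def)
    \<comment> \<open>The first half, applied to the extended tuple, supplies the comparison with
      \<open>\<tau>\<close>, its first entry.\<close>
    moreover have "AE \<omega> in M. cond_exp_at M F \<sigma> (payoff Y (Suc m) \<eta>) \<omega> \<le> cond_exp_at M F \<sigma> (?g \<tau>) \<omega>"
      using upper[OF \<eta>] by (simp only: \<eta>1)
    ultimately show "\<exists>h. integrable M h \<and> (AE \<omega> in M. h \<omega> \<le> cond_exp_at M F \<sigma> (?g \<tau>) \<omega>) \<and>
        (AE \<omega> in M. h \<omega> \<le> ?V \<omega>) \<and> expectation (cond_exp_at M F \<sigma> (?g \<tau>)) \<le> expectation h + e"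
      using integrable_cond_exp_at[OF \<sigma> integrable_payoff[OF \<eta>]] by blast
  qed
  show ?thesis
    unfolding is_ess_sup_def
  proof (intro conjI ballI impI)
    show "?V \<in> borel_measurable M"
      using V_ess by (simp add: is_ess_sup_def)
    show "AE \<omega> in M. h \<omega> \<le> ?V \<omega>" if "h \<in> (\<lambda>\<tau>. cond_exp_at M F \<sigma> (?g \<tau>)) ` stopping_times_from M F \<sigma>" for h
      using that lower by auto
    fix Z' assume Z': "Z' \<in> borel_measurable M"
      and ub: "\<forall>h\<in>(\<lambda>\<tau>. cond_exp_at M F \<sigma> (?g \<tau>)) ` stopping_times_from M F \<sigma>. AE \<omega> in M. h \<omega> \<le> Z' \<omega>"
    have "AE \<omega> in M. cond_exp_at M F \<sigma> (payoff Y (Suc m) \<tau>) \<omega> \<le> Z' \<omega>"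
      if \<tau>: "\<tau> \<in> multi_stopping_times M F X (Suc m) B \<sigma>" for \<tau>
    proof -
      have "\<tau> 1 \<in> stopping_times_from M F \<sigma>"
        using \<tau> by (auto simp: multi_stopping_times_def stopping_times_from_def)
      then have "AE \<omega> in M. cond_exp_at M F \<sigma> (?g (\<tau> 1)) \<omega> \<le> Z' \<omega>"
        using ub by blast
      with upper[OF \<tau>] show ?thesis
        by eventually_elim simp
    qed
    then show "AE \<omega> in M. ?V \<omega> \<le> Z' \<omega>"
      using V_ess Z' by (auto simp: is_ess_sup_def)
  qed
qed

section \<open>Adaptedness of the modification, and conclusion\<close>

text \<open>Here the null sets in \<open>F 0\<close> enter. A modification is only known to be
  measurable for \<open>M\<close>, but it differs from a conditional expectation given
  \<open>F t\<close> on a null set, and every null set belongs to \<open>F t\<close>.\<close>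

lemma borel_measurable_F_AE:
  fixes f g :: "'a \<Rightarrow> real"
  assumes f[measurable]: "f \<in> borel_measurable M" and g: "g \<in> borel_measurable (F t)"
    and eq: "AE \<omega> in M. f \<omega> = g \<omega>"
  shows "f \<in> borel_measurable (F t)"
proof (rule borel_measurableI_le)
  fix a
  have [measurable]: "g \<in> borel_measurable M"
    using g by (rule measurable_F_imp)
  have null: "{\<omega> \<in> space M. f \<omega> \<noteq> g \<omega>} \<in> null_sets M"
    using eq by (subst (asm) AE_iff_null) measurable
  have null': "{\<omega> \<in> space M. f \<omega> \<le> a \<and> f \<omega> \<noteq> g \<omega>} \<in> null_sets M"
    by (rule null_sets_subset[OF null]) auto
  have "{\<omega> \<in> space (F t). g \<omega> \<le> a} \<in> sets (F t)"
    using g by measurable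
  then have "({\<omega> \<in> space (F t). g \<omega> \<le> a} - {\<omega> \<in> space M. f \<omega> \<noteq> g \<omega>}) \<union>
      {\<omega> \<in> space M. f \<omega> \<le> a \<and> f \<omega> \<noteq> g \<omega>} \<in> sets (F t)"
    by (rule sets.Un[OF sets.Diff[OF _ null_sets_F[OF null]] null_sets_F[OF null']])
  also have "({\<omega> \<in> space (F t). g \<omega> \<le> a} - {\<omega> \<in> space M. f \<omega> \<noteq> g \<omega>}) \<union>
      {\<omega> \<in> space M. f \<omega> \<le> a \<and> f \<omega> \<noteq> g \<omega>} = {\<omega> \<in> space (F t). f \<omega> \<le> a}"
    by (auto simp: space_F)
  finally show "{\<omega> \<in> space (F t). f \<omega> \<le> a} \<in> sets (F t)" .
qed

end

text \<open>This and the next two lemmas allow changing the sets outside the relevant range of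
  indices, so that entry times can be assumed to be stopping times for every index.\<close>

lemma multi_stopping_times_cong:
  "(\<And>i. i \<in> {1..<m} \<Longrightarrow> C i = C' i) \<Longrightarrow> multi_stopping_times M F X m C \<sigma> = multi_stopping_times M F X m C' \<sigma>"
  by (auto simp: multi_stopping_times_def)

lemma multi_value_cong:
  assumes "\<And>i. i \<in> {1..<m} \<Longrightarrow> C i = C' i"
  shows "multi_value M F X Y m C \<sigma> = multi_value M F X Y m C' \<sigma>"
proof -
  have "multi_stopping_times M F X m C \<sigma> = multi_stopping_times M F X m C' \<sigma>"
    using assms by (rule multi_stopping_times_cong)
  then show ?thesis
    by (simp add: multi_value_def)
qed

lemma multi_value_next_cong:
  assumes "\<And>i. i \<in> {1..m} \<Longrightarrow> B i = B' i"
  shows "multi_value_next M F X Y m B = multi_value_next M F X Y m B'"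
proof (cases "m = 0")
  \<comment> \<open>\<open>B 1\<close> and \<open>B' 1\<close> may differ here, but the value at
    their entry times is 0 in both cases.\<close>
  case True
  then show ?thesis
    by (simp add: multi_value_next_def[abs_def] multi_value_def)
next
  case False
  then have "B 1 = B' 1"
    using assms by auto
  moreover have "multi_value M F X Y m (\<lambda>i. B (Suc i)) \<sigma> = multi_value M F X Y m (\<lambda>i. B' (Suc i)) \<sigma>" for \<sigma>
    using assms by (intro multi_value_cong) auto
  ultimately show ?thesis
    by (simp add: multi_value_next_def[abs_def])
qed

theorem theorem5p4:
  fixes M :: "'a measure"
    and F :: "ennreal \<Rightarrow> 'a measure"
    and Y R Yn :: "ennreal \<Rightarrow> 'a \<Rightarrow> real"
    and X :: "ennreal \<Rightarrow> 'a \<Rightarrow> 'b::topological_space"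
    and B :: "nat \<Rightarrow> 'b set"
    and n :: nat
  assumes "prob_space M"
    and "usual_filtration M F"
    and "adapted_process F Y"
    and "right_continuous_process M Y"
    and "\<forall>t<\<infinity>. \<forall>\<omega>\<in>space M. 0 \<le> Y t \<omega>"
    and "(\<integral>\<^sup>+\<omega>. (SUP t\<in>{..<\<infinity>}. ennreal (Y t \<omega>)) \<partial>M) < \<infinity>"
    and "limsup_at_infinity M Y"
    and "1 \<le> n"
    and "adapted_process F X"
    and "right_continuous_process M X"
    and "\<forall>i\<in>{1..<n}. B i \<in> sets borel"
    and "\<forall>i\<in>{1..<n}. \<forall>s<\<infinity>. {\<omega>\<in>space M. \<forall>t. s < t \<and> t < \<infinity> \<longrightarrow> X t \<omega> \<notin> B i} \<in> null_sets M"
    and "\<forall>i\<in>{1..<n}. \<forall>s<\<infinity>. stopping_time F (entry_after X (B i) (\<lambda>_. s))"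
    and "modification M (multi_value_next M F X Y (n - 1) B) R"
    and "right_continuous_process M R"
    and "Yn = (\<lambda>t \<omega>. Y t \<omega> + R t \<omega>)"
  shows "adapted_process F Yn \<and>
    right_continuous_process M Yn \<and>
    (\<forall>\<sigma>. stopping_time F \<sigma> \<longrightarrow>
      (AE \<omega> in M. multi_value M F X Y n B \<sigma> \<omega> =
        ess_sup M ((\<lambda>\<tau>. cond_exp_at M F \<sigma> (\<lambda>\<omega>'. Yn (\<tau> \<omega>') \<omega>')) ` stopping_times_from M F \<sigma>) \<omega>))"
proof (intro conjI allI impI)
  interpret reward_process M F Y
    using assms(1-7) by (intro reward_process.intro reward_process_axioms.intro)
  define m where "m = n - 1"
  have n: "n = Suc m"
    using assms(8) by (simp add: m_def)
  have R: "R t \<in> borel_measurable M" "AE \<omega> in M. R t \<omega> = multi_value_next M F X Y m B t \<omega>" for t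
    using assms(14) by (simp_all add: modification_def m_def)
  have "R t \<in> borel_measurable (F t)" for t
    using R(2) by (rule borel_measurable_F_AE[OF R(1), rotated]) (simp add: multi_value_next_def)
  then show "adapted_process F Yn"
    using assms(3) by (auto simp: adapted_process_def assms(16))
  show "right_continuous_process M Yn"
    using assms(4,15) by (auto simp: right_continuous_process_def assms(16) intro!: tendsto_add)
  fix \<sigma> assume \<sigma>: "stopping_time F \<sigma>"
  \<comment> \<open>Only \<open>B 1, \<dots>, B m\<close> matter; the other sets are made empty so that every entry time is a stopping time.\<close>
  define B' where "B' = (\<lambda>i. if i \<in> {1..m} then B i else {})"
  have entry: "stopping_time F (entry_after X (B' i) (\<lambda>_. t))" for i t
  proof (cases "i \<in> {1..m} \<and> t < \<infinity>")
    case True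
    then show ?thesis
      using assms(13) by (simp add: B'_def n)
  next
    case False
    \<comment> \<open>Either the set is empty or the start is infinite; in both cases the infimum is
      over the empty set.\<close>
    then have "entry_after X (B' i) (\<lambda>_. t) = (\<lambda>_. \<infinity>)"
      unfolding entry_after_def using eq_infinityI[of t] by (auto simp: B'_def)
    then show ?thesis
      by (simp only: stopping_time_const)
  qed
  have "multi_value_next M F X Y m B = multi_value_next M F X Y m B'"
    by (rule multi_value_next_cong) (simp add: B'_def)
  then have "modification M (multi_value_next M F X Y m B') R"
    using assms(14) by (simp add: m_def)
  then have "is_ess_sup M ((\<lambda>\<tau>. cond_exp_at M F \<sigma> (\<lambda>\<omega>. Y (\<tau> \<omega>) \<omega> + R (\<tau> \<omega>) \<omega>)) ` stopping_times_from M F \<sigma>)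
      (multi_value M F X Y (Suc m) B' \<sigma>)"
    using multi_value_Suc[where B=B', OF entry _ assms(15) \<sigma>] by blast
  moreover have "multi_value M F X Y (Suc m) B' \<sigma> = multi_value M F X Y n B \<sigma>"
    unfolding n by (rule multi_value_cong) (simp add: B'_def)
  ultimately show "AE \<omega> in M. multi_value M F X Y n B \<sigma> \<omega> =
      ess_sup M ((\<lambda>\<tau>. cond_exp_at M F \<sigma> (\<lambda>\<omega>'. Yn (\<tau> \<omega>') \<omega>')) ` stopping_times_from M F \<sigma>) \<omega>"
    by (simp add: assms(16) ess_sup_eqI)
qed

end
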